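(* Let $\mathcal{P}$ be a nice pointclass with the property of Baire, and suppose $X$ is a path connected, locally path connected Polish space. If $G \unlhd \pi_1(X)$ is a normal subgroup of pointclass $\mathcal{P}$, then $\operatorname{card}(\pi_1(X)/G)$ is either $\leq \aleph_0$ (in case $G$ is open) or $2^{\aleph_0}$ (in case $G$ is not open).
   Context: For a path connected metric space $X$ and $x\in X$, $L_x$ is the set of loops $[0,1]\to X$ based at $x$ with the sup metric. For $G\leq \pi_1(X,x)$, $\bigcup G\subseteq L_x$ is the set of all loops whose homotopy class lies in $G$; $G$ is open (resp. of pointclass $\mathcal{P}$) if $\bigcup G$ is open (resp. belongs to $\mathcal{P}$) in $L_x$. For normal subgroups and the classes considered here this does not depend on the basepoint, so one writes $\pi_1(X)$. A space is Polish if it is completely metrizable and separable; $L_x$ is Polish when $X$ is. A pointclass on Polish spaces assigns to each Polish space a collection of its subsets (of a given topological description). It is nice if it contains the closed sets and is closed under continuous images and preimages (between Polish spaces), countable intersections and finite unions. A subset $Y$ of a space $Z$ has the property of Baire (BP) if there is an open $O\subseteq Z$ with $Y\Delta O$ meager; a pointclass on Polish spaces has BP if each set in it has BP. *)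

theory Defs
  imports "HOL-Analysis.Analysis" "HOL-Algebra.Coset"
begin

section \<open>Polish spaces and the property of Baire\<close>

definition polish_topology :: "'a topology \<Rightarrow> bool" where
  "polish_topology Z \<longleftrightarrow> completely_metrizable_space Z \<and> separable_space Z"

definition nowhere_dense_in :: "'a topology \<Rightarrow> 'a set \<Rightarrow> bool" where
  "nowhere_dense_in Z S \<longleftrightarrow> S \<subseteq> topspace Z \<and> Z interior_of (Z closure_of S) = {}"

definition meager_in :: "'a topology \<Rightarrow> 'a set \<Rightarrow> bool" where
  "meager_in Z S \<longleftrightarrow> (\<exists>N :: nat \<Rightarrow> 'a set. (\<forall>n. nowhere_dense_in Z (N n)) \<and> S = (\<Union>n. N n))"

definition baire_property :: "'a topology \<Rightarrow> 'a set \<Rightarrow> bool" where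
  "baire_property Z Y \<longleftrightarrow>
     Y \<subseteq> topspace Z \<and> (\<exists>U. openin Z U \<and> meager_in Z ((Y - U) \<union> (U - Y)))"


section \<open>Pointclasses\<close>

text \<open>A pointclass is a map assigning to each Polish space a collection of its subsets. HOL has no
  quantification over types inside a formula, so the Polish spaces a pointclass is applied to are
  taken to be those whose points are real numbers (with an arbitrary Polish topology on an arbitrary
  set of reals). A Polish space has at most continuum many points, so every Polish space is
  homeomorphic to one of these; see \<open>polish_topology_homeomorphic_real\<close>. The values of a pointclass at
  topologies that are not Polish are irrelevant.\<close>

type_synonym pointclass = "real topology \<Rightarrow> real set set"

definition pointclass :: "pointclass \<Rightarrow> bool" where
  "pointclass P \<longleftrightarrow> (\<forall>Z. polish_topology Z \<longrightarrow> P Z \<subseteq> Pow (topspace Z))"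

definition nice_pointclass :: "pointclass \<Rightarrow> bool" where
  "nice_pointclass P \<longleftrightarrow> pointclass P \<and>
     (\<forall>Z C. polish_topology Z \<and> closedin Z C \<longrightarrow> C \<in> P Z) \<and>
     (\<forall>Z W f A. polish_topology Z \<and> polish_topology W \<and> continuous_map Z W f \<and> A \<in> P Z
        \<longrightarrow> f ` A \<in> P W) \<and>
     (\<forall>Z W f B. polish_topology Z \<and> polish_topology W \<and> continuous_map Z W f \<and> B \<in> P W
        \<longrightarrow> {z \<in> topspace Z. f z \<in> B} \<in> P Z) \<and>
     (\<forall>Z. \<forall>A :: nat \<Rightarrow> real set. polish_topology Z \<and> (\<forall>n. A n \<in> P Z) \<longrightarrow> (\<Inter>n. A n) \<in> P Z) \<and>
     (\<forall>Z A B. polish_topology Z \<and> A \<in> P Z \<and> B \<in> P Z \<longrightarrow> A \<union> B \<in> P Z)"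

definition pointclass_has_BP :: "pointclass \<Rightarrow> bool" where
  "pointclass_has_BP P \<longleftrightarrow> (\<forall>Z A. polish_topology Z \<and> A \<in> P Z \<longrightarrow> baire_property Z A)"

text \<open>Membership in a pointclass for a subset of a Polish space with points of any type, via a
  homeomorphic copy on a set of reals. For nice pointclasses the choice of the copy is immaterial; see
  \<open>in_pointclass_iff_all_copies\<close>.\<close>

definition in_pointclass :: "pointclass \<Rightarrow> 'a topology \<Rightarrow> 'a set \<Rightarrow> bool" where
  "in_pointclass P Z A \<longleftrightarrow>
     A \<subseteq> topspace Z \<and> (\<exists>T h. homeomorphic_map Z T h \<and> h ` A \<in> P T)"

lemma homeomorphic_polish_topology:
  assumes "Z homeomorphic_space T"
  shows "polish_topology Z \<longleftrightarrow> polish_topology T"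
  unfolding polish_topology_def
  using homeomorphic_completely_metrizable_space[OF assms] homeomorphic_separable_space[OF assms]
  by blast

lemma polish_topology_homeomorphic_real:
  fixes Z :: "'a topology"
  assumes "polish_topology Z"
  obtains T :: "real topology" and h where "polish_topology T" "homeomorphic_map Z T h"
proof -
  obtain M d where md: "Metric_space M d" and Z: "Z = Metric_space.mtopology M d"
    using assms by (auto simp: polish_topology_def completely_metrizable_space_def)
  interpret Metric_space M d by (rule md)
  obtain C where C: "countable C" "C \<subseteq> M" "mtopology closure_of C = M"
    using assms by (auto simp: polish_topology_def separable_space_def Z)
  define e where "e z = {(c, q). c \<in> C \<and> d z c < real_of_rat q}" for z
  have e_inj: "inj_on e M"
  proof (rule inj_onI, rule ccontr)
    fix x y assume xy: "x \<in> M" "y \<in> M" "e x = e y" "x \<noteq> y"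
    define r where "r = d x y / 2"
    have "r > 0" using xy by (simp add: r_def)
    then obtain c where c: "c \<in> C" "d x c < r"
      using C(3) xy(1) by (fastforce simp: metric_closure_of in_mball)
    then obtain q where q: "d x c < real_of_rat q" "real_of_rat q < r"
      using of_rat_dense by blast
    then have "(c, q) \<in> e y" using c xy(3) by (auto simp: e_def)
    then have "d y c < r" using q by (auto simp: e_def)
    moreover have "d x y \<le> d x c + d y c"
      using triangle[of x c y] commute[of y c] xy C c by auto
    ultimately show False using c by (simp add: r_def)
  qed
  have "e ` M \<subseteq> Pow (C \<times> UNIV)" by (auto simp: e_def)
  have "M \<lesssim> Pow (C \<times> (UNIV :: rat set))"
    unfolding lepoll_def using e_inj \<open>e ` M \<subseteq> _\<close> by blast
  also have "C \<times> (UNIV :: rat set) \<lesssim> (UNIV :: nat set)"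
    using countable_SIGMA[OF C(1), of "\<lambda>_. UNIV :: rat set"] unfolding countable_def lepoll_def
    by blast
  then have "Pow (C \<times> (UNIV :: rat set)) \<lesssim> Pow (UNIV :: nat set)"
    unfolding lepoll_def by (meson image_Pow_mono inj_on_image_Pow)
  also have "Pow (UNIV :: nat set) \<approx> (UNIV :: real set)"
    by (simp add: nat_sets_eqpoll_reals)
  finally obtain h :: "'a \<Rightarrow> real" where h: "inj_on h M"
    unfolding lepoll_def by blast
  define g where "g = inv_into M h"
  define T where "T = pullback_topology (h ` M) g Z"
  have gh: "g (h x) = x" if "x \<in> M" for x
    using that h by (simp add: g_def)
  have top: "topspace T = h ` M"
    using gh by (auto simp: T_def topspace_pullback_topology Z)
  have "continuous_map T Z g"
    using gh top unfolding continuous_map_def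
    by (auto simp: T_def openin_pullback_topology Z intro!: exI)
  moreover have "continuous_map Z T h"
    unfolding continuous_map_def
  proof (intro conjI allI impI)
    show "h \<in> topspace Z \<rightarrow> topspace T" by (auto simp: top Z)
    fix U assume "openin T U"
    then obtain V where V: "openin Z V" "U = g -` V \<inter> h ` M"
      by (auto simp: T_def openin_pullback_topology)
    have "{x \<in> topspace Z. h x \<in> U} = V"
      using gh V openin_subset[OF V(1)] by (auto simp: Z inj_on_eq_iff[OF h])
    then show "openin Z {x \<in> topspace Z. h x \<in> U}" using V by simp
  qed
  ultimately have "homeomorphic_maps Z T h g"
    using gh top by (auto simp: homeomorphic_maps_def Z)
  then have hm: "homeomorphic_map Z T h"
    using homeomorphic_maps_map by blast
  then have "polish_topology T"
    using assms homeomorphic_polish_topology homeomorphic_map_imp_homeomorphic_space by blast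
  then show thesis using hm that by blast
qed

lemma in_pointclass_iff_all_copies:
  assumes P: "nice_pointclass P" and Z: "polish_topology Z"
  shows "in_pointclass P Z A \<longleftrightarrow>
    A \<subseteq> topspace Z \<and> (\<forall>T h. homeomorphic_map Z T h \<longrightarrow> h ` A \<in> P T)"
proof
  assume "in_pointclass P Z A"
  then obtain T h where A: "A \<subseteq> topspace Z" and h: "homeomorphic_map Z T h" and m: "h ` A \<in> P T"
    by (auto simp: in_pointclass_def)
  obtain h' where h': "homeomorphic_maps Z T h h'"
    using h homeomorphic_map_maps by blast
  have "k ` A \<in> P W" if k: "homeomorphic_map Z W k" for W k
  proof -
    have pol: "polish_topology T" "polish_topology W"
      using Z h k homeomorphic_polish_topology homeomorphic_map_imp_homeomorphic_space by blast+
    have "continuous_map T W (k \<circ> h')"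
      using h' k by (meson continuous_map_compose homeomorphic_imp_continuous_map homeomorphic_maps_def)
    then have "(k \<circ> h') ` (h ` A) \<in> P W"
      using P pol m unfolding nice_pointclass_def by blast
    moreover have "(k \<circ> h') ` (h ` A) = k ` A"
      using h' A by (force simp: homeomorphic_maps_def image_iff subset_iff)
    ultimately show ?thesis by simp
  qed
  then show "A \<subseteq> topspace Z \<and> (\<forall>T h. homeomorphic_map Z T h \<longrightarrow> h ` A \<in> P T)"
    using A by blast
next
  assume "A \<subseteq> topspace Z \<and> (\<forall>T h. homeomorphic_map Z T h \<longrightarrow> h ` A \<in> P T)"
  then show "in_pointclass P Z A"
    using polish_topology_homeomorphic_real[OF Z] unfolding in_pointclass_def by metis
qed


section \<open>Loop space and fundamental group\<close>

text \<open>The elements are functions on the reals that are \<^const>\<open>undefined\<close> outside the unit interval, so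
  that a loop is determined by its values on \<open>[0,1]\<close>. The metric of \<^const>\<open>cfunspace\<close> is the sup
  metric.\<close>

definition loop_space :: "'a::metric_space set \<Rightarrow> 'a \<Rightarrow> (real \<Rightarrow> 'a) metric" where
  "loop_space X x =
     submetric (cfunspace (top_of_set {0..1}) (submetric euclidean_metric X)) {p. p 0 = x \<and> p 1 = x}"

abbreviation loops :: "'a::metric_space set \<Rightarrow> 'a \<Rightarrow> (real \<Rightarrow> 'a) set" where
  "loops X x \<equiv> mspace (loop_space X x)"

definition loop_homotopy :: "'a::metric_space set \<Rightarrow> 'a \<Rightarrow> ((real \<Rightarrow> 'a) \<times> (real \<Rightarrow> 'a)) set" where
  "loop_homotopy X x = {(p, q). p \<in> loops X x \<and> q \<in> loops X x \<and> homotopic_paths X p q}"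

text \<open>The group elements are the homotopy classes themselves, i.e. sets of loops. Hence for a set \<open>G\<close>
  of group elements, \<open>\<Union>G\<close> is the set of all loops whose class lies in \<open>G\<close>.\<close>

definition fundamental_group :: "'a::metric_space set \<Rightarrow> 'a \<Rightarrow> (real \<Rightarrow> 'a) set monoid" where
  "fundamental_group X x =
     \<lparr>carrier = loops X x // loop_homotopy X x,
      mult = (\<lambda>A B. \<Union>p\<in>A. \<Union>q\<in>B. loop_homotopy X x `` {restrict (p +++ q) {0..1}}),
      one = loop_homotopy X x `` {restrict (\<lambda>t. x) {0..1}}\<rparr>"

lemma loops_iff:
  "p \<in> loops X x \<longleftrightarrow>
    p \<in> extensional {0..1} \<and> path p \<and> path_image p \<subseteq> X \<and> pathstart p = x \<and> pathfinish p = x"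
proof -
  have "Metric_space.mbounded X dist (p ` {0..1})" if "path p" "path_image p \<subseteq> X"
  proof -
    interpret Metric_space X dist by (simp add: Metric_space_def dist_commute dist_triangle)
    have "bounded (p ` {0..1})"
      using that(1) bounded_path_image by (auto simp: path_image_def)
    then show ?thesis
      using that(2) unfolding mbounded_alt bounded_two_points path_image_def
      by (meson bounded_two_points subsetD)
  qed
  moreover have "mtopology_of (submetric euclidean_metric X) = top_of_set X"
    by (simp add: mtopology_of_submetric)
  ultimately show ?thesis
    by (auto simp: loop_space_def path_def path_image_def pathstart_def pathfinish_def Pi_iff
        image_subset_iff)
qed

lemma restrict_loop:
  assumes "path p" "path_image p \<subseteq> X" "pathstart p = x" "pathfinish p = x"
  shows "restrict p {0..1} \<in> loops X x" "homotopic_paths X p (restrict p {0..1})"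
proof -
  show h: "homotopic_paths X p (restrict p {0..1})"
    using assms by (intro homotopic_paths_eq) auto
  show "restrict p {0..1} \<in> loops X x"
    using assms homotopic_paths_imp_path[OF h] homotopic_paths_imp_subset[OF h]
      homotopic_paths_imp_pathstart[OF h] homotopic_paths_imp_pathfinish[OF h]
    by (auto simp: loops_iff)
qed

lemma equiv_loop_homotopy: "equiv (loops X x) (loop_homotopy X x)"
  by (intro equivI refl_onI symI transI)
     (auto simp: loop_homotopy_def loops_iff intro: homotopic_paths_sym homotopic_paths_trans)

lemma fundamental_group_mult_class:
  assumes "p \<in> loops X x" "q \<in> loops X x"
  shows "loop_homotopy X x `` {p} \<otimes>\<^bsub>fundamental_group X x\<^esub> loop_homotopy X x `` {q}
    = loop_homotopy X x `` {restrict (p +++ q) {0..1}}"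
proof -
  have *: "loop_homotopy X x `` {restrict (p' +++ q') {0..1}}
      = loop_homotopy X x `` {restrict (p +++ q) {0..1}}"
    if "(p, p') \<in> loop_homotopy X x" "(q, q') \<in> loop_homotopy X x" for p' q'
  proof -
    have L: "p' \<in> loops X x" "q' \<in> loops X x" "homotopic_paths X p p'" "homotopic_paths X q q'"
      using that by (auto simp: loop_homotopy_def)
    have h: "homotopic_paths X (p +++ q) (p' +++ q')"
      using L assms by (intro homotopic_paths_join) (auto simp: loops_iff)
    have r1: "restrict (p +++ q) {0..1} \<in> loops X x"
        "homotopic_paths X (p +++ q) (restrict (p +++ q) {0..1})"
      using assms by (intro restrict_loop; auto simp: loops_iff subset_path_image_join)+
    have r2: "restrict (p' +++ q') {0..1} \<in> loops X x"
        "homotopic_paths X (p' +++ q') (restrict (p' +++ q') {0..1})"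
      using L by (intro restrict_loop; auto simp: loops_iff subset_path_image_join)+
    have "(restrict (p' +++ q') {0..1}, restrict (p +++ q) {0..1}) \<in> loop_homotopy X x"
      using r1 r2 h unfolding loop_homotopy_def
      by (blast intro: homotopic_paths_sym homotopic_paths_trans)
    then show ?thesis using equiv_loop_homotopy by (rule equiv_class_eq[rotated])
  qed
  have self: "p \<in> loop_homotopy X x `` {p}" "q \<in> loop_homotopy X x `` {q}"
    using assms equiv_class_self[OF equiv_loop_homotopy] by auto
  have "(\<Union>p'\<in>loop_homotopy X x `` {p}. \<Union>q'\<in>loop_homotopy X x `` {q}.
      loop_homotopy X x `` {restrict (p' +++ q') {0..1}})
    = (\<Union>p'\<in>loop_homotopy X x `` {p}. \<Union>q'\<in>loop_homotopy X x `` {q}.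
      loop_homotopy X x `` {restrict (p +++ q) {0..1}})"
    by (intro SUP_cong refl *) auto
  also have "\<dots> = loop_homotopy X x `` {restrict (p +++ q) {0..1}}"
    using self by blast
  finally show ?thesis by (simp only: fundamental_group_def monoid.simps)
qed

lemma homotopic_paths_const_join:
  assumes "path p" "path_image p \<subseteq> X"
  shows "homotopic_paths X ((\<lambda>t. pathstart p) +++ p) p"
proof -
  have "homotopic_paths {0..1} (linepath 0 0 +++ id) (id :: real \<Rightarrow> real)"
    using homotopic_paths_lid[of "id :: real \<Rightarrow> real" "{0..1}"]
    by (simp add: path_def path_image_def pathstart_def)
  then have "homotopic_paths X (p \<circ> (linepath 0 0 +++ id)) (p \<circ> id)"
    by (rule homotopic_paths_continuous_image) (use assms in \<open>auto simp: path_def path_image_def\<close>)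
  then show ?thesis
    unfolding path_compose_join by (simp add: linepath_refl comp_def pathstart_def)
qed

lemma homotopic_paths_reversepath_join:
  assumes "path p" "path_image p \<subseteq> X"
  shows "homotopic_paths X (reversepath p +++ p) (\<lambda>t. pathfinish p)"
proof -
  have "homotopic_paths {0..1} (reversepath id +++ id) (linepath 1 1 :: real \<Rightarrow> real)"
    using homotopic_paths_linv[of "id :: real \<Rightarrow> real" "{0..1}"]
    by (simp add: path_def path_image_def pathfinish_def)
  then have "homotopic_paths X (p \<circ> (reversepath id +++ id)) (p \<circ> linepath 1 1)"
    by (rule homotopic_paths_continuous_image) (use assms in \<open>auto simp: path_def path_image_def\<close>)
  then show ?thesis
    unfolding path_compose_join path_compose_reversepath
    by (simp add: linepath_refl comp_def pathfinish_def)
qed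

lemma group_fundamental_group:
  assumes "x \<in> X"
  shows "Group.group (fundamental_group X x)"
proof -
  let ?c = "\<lambda>p. loop_homotopy X x `` {p}" and ?r = "\<lambda>p. restrict p {0..1::real}"
  let ?G = "fundamental_group X x"
  have car: "carrier ?G = ?c ` loops X x"
    by (auto simp: fundamental_group_def quotient_def)
  have one: "\<one>\<^bsub>?G\<^esub> = ?c (?r ((\<lambda>t. x)))"
    by (simp add: fundamental_group_def)
  have ceq: "?c p = ?c q" if "homotopic_paths X p q" "p \<in> loops X x" "q \<in> loops X x" for p q
    using that by (intro equiv_class_eq[OF equiv_loop_homotopy]) (auto simp: loop_homotopy_def)
  have e: "?r ((\<lambda>t. x)) \<in> loops X x" "homotopic_paths X ((\<lambda>t. x)) (?r ((\<lambda>t. x)))"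
    using assms
    by (intro restrict_loop; auto simp: path_def path_image_def pathstart_def pathfinish_def)+
  have j: "?r (p +++ q) \<in> loops X x" "homotopic_paths X (p +++ q) (?r (p +++ q))"
    if "p \<in> loops X x" "q \<in> loops X x" for p q
    using that by (intro restrict_loop; auto simp: loops_iff subset_path_image_join)+
  have rv: "?r (reversepath p) \<in> loops X x" "homotopic_paths X (reversepath p) (?r (reversepath p))"
    if "p \<in> loops X x" for p
    using that by (intro restrict_loop; auto simp: loops_iff)+
  note m = fundamental_group_mult_class
  show ?thesis
  proof (rule groupI)
    fix A B assume "A \<in> carrier ?G" "B \<in> carrier ?G"
    then show "A \<otimes>\<^bsub>?G\<^esub> B \<in> carrier ?G" by (auto simp: car m j)
  next
    show "\<one>\<^bsub>?G\<^esub> \<in> carrier ?G" using e by (auto simp: car one)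
  next
    fix A B C assume "A \<in> carrier ?G" "B \<in> carrier ?G" "C \<in> carrier ?G"
    then obtain p q s where L: "p \<in> loops X x" "q \<in> loops X x" "s \<in> loops X x"
      and eq: "A = ?c p" "B = ?c q" "C = ?c s"
      by (auto simp: car)
    have 1: "homotopic_paths X (?r (p +++ q) +++ s) ((p +++ q) +++ s)"
      using L j by (intro homotopic_paths_join homotopic_paths_sym[OF j(2)]) (auto simp: loops_iff)
    have 2: "homotopic_paths X ((p +++ q) +++ s) (p +++ (q +++ s))"
      using L by (intro homotopic_paths_sym[OF homotopic_paths_assoc]) (auto simp: loops_iff)
    have 3: "homotopic_paths X (p +++ (q +++ s)) (p +++ ?r (q +++ s))"
      using L j by (intro homotopic_paths_join j(2)) (auto simp: loops_iff)
    have "?c (?r (?r (p +++ q) +++ s)) = ?c (?r (p +++ ?r (q +++ s)))"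
      using L j by (intro ceq homotopic_paths_trans[OF homotopic_paths_sym[OF j(2)]]
          homotopic_paths_trans[OF 1] homotopic_paths_trans[OF 2] homotopic_paths_trans[OF 3]) auto
    then show "(A \<otimes>\<^bsub>?G\<^esub> B) \<otimes>\<^bsub>?G\<^esub> C = A \<otimes>\<^bsub>?G\<^esub> (B \<otimes>\<^bsub>?G\<^esub> C)"
      using L by (simp add: eq m j)
  next
    fix A assume "A \<in> carrier ?G"
    then obtain p where L: "p \<in> loops X x" and A: "A = ?c p" by (auto simp: car)
    have p: "path p" "path_image p \<subseteq> X" "pathstart p = x" "pathfinish p = x"
      using L by (auto simp: loops_iff)
    have 1: "homotopic_paths X (?r ((\<lambda>t. x)) +++ p) ((\<lambda>t. x) +++ p)"
      using p by (intro homotopic_paths_join homotopic_paths_sym[OF e(2)])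
        (use e(1)[unfolded loops_iff] in auto)
    have 2: "homotopic_paths X ((\<lambda>t. x) +++ p) p"
      using homotopic_paths_const_join[OF p(1,2)] p by simp
    have "?c (?r (?r ((\<lambda>t. x)) +++ p)) = ?c p"
      using L e j by (intro ceq homotopic_paths_trans[OF homotopic_paths_sym[OF j(2)]]
          homotopic_paths_trans[OF 1 2]) auto
    then show "\<one>\<^bsub>?G\<^esub> \<otimes>\<^bsub>?G\<^esub> A = A"
      using L e by (simp add: one A m)
    have 3: "homotopic_paths X (?r (reversepath p) +++ p) (reversepath p +++ p)"
      using p by (intro homotopic_paths_join homotopic_paths_sym[OF rv(2)[OF L]])
        (use rv(1)[OF L, unfolded loops_iff] in auto)
    have 4: "homotopic_paths X (reversepath p +++ p) ((\<lambda>t. x))"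
      using homotopic_paths_reversepath_join[OF p(1,2)] p by simp
    have "?c (?r (?r (reversepath p) +++ p)) = ?c (?r ((\<lambda>t. x)))"
      using L e j rv by (intro ceq homotopic_paths_trans[OF homotopic_paths_sym[OF j(2)]]
          homotopic_paths_trans[OF 3] homotopic_paths_trans[OF 4] e(2)) auto
    then have "?c (?r (reversepath p)) \<otimes>\<^bsub>?G\<^esub> A = \<one>\<^bsub>?G\<^esub>"
      using L rv by (simp add: one A m)
    then show "\<exists>B \<in> carrier ?G. B \<otimes>\<^bsub>?G\<^esub> A = \<one>\<^bsub>?G\<^esub>"
      using rv[OF L] by (auto simp: car)
  qed
qed

definition open_subgroup :: "'a::metric_space set \<Rightarrow> 'a \<Rightarrow> (real \<Rightarrow> 'a) set set \<Rightarrow> bool" where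
  "open_subgroup X x G \<longleftrightarrow> openin (mtopology_of (loop_space X x)) (\<Union>G)"

definition subgroup_of_pointclass ::
  "pointclass \<Rightarrow> 'a::metric_space set \<Rightarrow> 'a \<Rightarrow> (real \<Rightarrow> 'a) set set \<Rightarrow> bool" where
  "subgroup_of_pointclass P X x G \<longleftrightarrow> in_pointclass P (mtopology_of (loop_space X x)) (\<Union>G)"

end

(* If G is open, its cosets are disjoint open sets of loops in a separable space. If G is not open, cut
   a loop in G and nearby loops outside G into small pieces: local path connectedness and normality
   yield a point z with arbitrarily small loops at z whose class, carried back to the base point, is
   not in G. Choose such loops s_0, s_1, ... shrinking to z, and for a binary sequence a let F(a) be the
   infinite concatenation of those s_n with a(n) = 1. Changing one digit of a changes F(a) modulo G, so
   the relation "F(a) and F(b) agree modulo G" on pairs of sequences, which has the property of Baire, is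
   disjoint from its image under a digit flip and hence meager. A meager set of sequences misses every
   sequence that agrees with a suitable fixed one on infinitely many blocks, which gives continuum many
   pairwise inequivalent sequences. *)

theory Submission
  imports Defs
begin

section \<open>Meager sets of sequences\<close>

text \<open>The Baire property enters through one continuous map: a pair (a, b) is sent to the loop
  that runs from the base point to z, along F(a), back along F(b) and home again. The relation is
  the preimage of \<open>\<Union>G\<close> under this map, hence it inherits the Baire property from
  the pointclass. Pairs of sequences are coded as sequences of pairs, so that one topology serves
  both. An infinite concatenation has no counterpart in the quotient group, so nothing is known
  about the class of F(a) itself. A digit flip, however, involves a finite product with a common
  tail; the tail cancels, and s_n is not trivial modulo \<open>G\<close>. Normality makes triviality
  modulo \<open>G\<close> independent of the path along which a loop is carried to the base point,
  so loops at different points can be compared. The given metric of \<open>X\<close> need not be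
  complete; completeness of the loop space is imported from another metric with the same topology.
  The upper bound in the second case holds because a Polish space has at most continuum many
  points.\<close>

definition seq_topology :: "(nat \<Rightarrow> 'c) topology" where
  "seq_topology = product_topology (\<lambda>_. discrete_topology UNIV) UNIV"

lemma topspace_seq_topology [simp]: "topspace seq_topology = UNIV"
  by (auto simp: seq_topology_def)

text \<open>Basic open sets constrain finitely many coordinates, so a bound on these coordinates
  turns them into initial segments. Later openness arguments then deal with lengths of initial
  segments only.\<close>

lemma openin_seq_topology:
  "openin seq_topology U \<longleftrightarrow> (\<forall>x\<in>U. \<exists>n. \<forall>y. (\<forall>i<n. y i = x i) \<longrightarrow> y \<in> U)"
proof
  assume U: "openin seq_topology U"
  show "\<forall>x\<in>U. \<exists>n. \<forall>y. (\<forall>i<n. y i = x i) \<longrightarrow> y \<in> U"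
  proof
    fix x assume "x \<in> U"
    then obtain V where V: "finite {i. V i \<noteq> UNIV}" "x \<in> Pi\<^sub>E UNIV V" "Pi\<^sub>E UNIV V \<subseteq> U"
      using U unfolding seq_topology_def openin_product_topology_alt by auto
    obtain n where n: "\<And>i. V i \<noteq> UNIV \<Longrightarrow> i < n"
      using V(1) by (auto simp: finite_nat_set_iff_bounded)
    have "y \<in> U" if "\<forall>i<n. y i = x i" for y
    proof -
      have "y i \<in> V i" for i
        using V(2) n[of i] that by (cases "V i = UNIV") (auto simp: PiE_iff)
      then show ?thesis using V(3) by (auto simp: PiE_iff subset_iff)
    qed
    then show "\<exists>n. \<forall>y. (\<forall>i<n. y i = x i) \<longrightarrow> y \<in> U" by blast
  qed
next
  assume R: "\<forall>x\<in>U. \<exists>n. \<forall>y. (\<forall>i<n. y i = x i) \<longrightarrow> y \<in> U"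
  show "openin seq_topology U"
    unfolding seq_topology_def openin_product_topology_alt
  proof (intro conjI ballI)
    fix x assume "x \<in> U"
    then obtain n where n: "\<And>y. (\<forall>i<n. y i = x i) \<Longrightarrow> y \<in> U" using R by blast
    define V where "V i = (if i < n then {x i} else UNIV)" for i
    have "finite {i \<in> UNIV. V i \<noteq> topspace (discrete_topology UNIV)}"
      by (rule finite_subset[of _ "{..<n}"]) (auto simp: V_def)
    moreover have "Pi\<^sub>E UNIV V \<subseteq> U"
      by (rule subsetI, rule n) (fastforce simp: V_def PiE_iff split: if_splits dest: spec)
    moreover have "x \<in> Pi\<^sub>E UNIV V" by (auto simp: V_def)
    ultimately show "\<exists>V. finite {i \<in> UNIV. V i \<noteq> topspace (discrete_topology UNIV)} \<and>
        (\<forall>i\<in>UNIV. openin (discrete_topology UNIV) (V i)) \<and> x \<in> Pi\<^sub>E UNIV V \<and> Pi\<^sub>E UNIV V \<subseteq> U"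
      by (intro exI[of _ V]) auto
  qed
qed

lemma polish_seq_topology: "polish_topology (seq_topology :: (nat \<Rightarrow> 'c::countable) topology)"
  unfolding polish_topology_def
proof
  show "completely_metrizable_space (seq_topology :: (nat \<Rightarrow> 'c) topology)"
    by (simp add: seq_topology_def completely_metrizable_space_product_topology
        completely_metrizable_space_discrete_topology)
  \<comment> \<open>Finite lists padded by \<open>undefined\<close>; any fixed padding value would
    do.\<close>
  define D :: "(nat \<Rightarrow> 'c) set" where
    "D = range (\<lambda>xs i. if i < length xs then xs ! i else undefined)"
  have "x \<in> seq_topology closure_of D" for x
    unfolding in_closure_of
  proof (intro conjI allI impI)
    fix T assume T: "x \<in> T \<and> openin seq_topology T"
    then obtain n where n: "\<And>y. (\<forall>i<n. y i = x i) \<Longrightarrow> y \<in> T"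
      unfolding openin_seq_topology by blast
    define y where "y = (\<lambda>i. if i < length (map x [0..<n]) then map x [0..<n] ! i else undefined)"
    have "y \<in> T" by (rule n) (auto simp: y_def)
    moreover have "y \<in> D" unfolding D_def y_def by blast
    ultimately show "\<exists>y. y \<in> D \<and> y \<in> T" by blast
  qed simp
  moreover have "countable D" by (simp add: D_def)
  ultimately show "separable_space (seq_topology :: (nat \<Rightarrow> 'c) topology)"
    unfolding separable_space_def by auto
qed

section \<open>Meager sets described by blocks of coordinates\<close>

lemma nowhere_dense_cylinder:
  assumes "nowhere_dense_in seq_topology S"
  obtains t m where "n \<le> m" "\<And>i. i < n \<Longrightarrow> t i = s i" "\<And>x. x \<in> S \<Longrightarrow> \<exists>i<m. x i \<noteq> t i"
proof -
  let ?C = "{t. \<forall>i<n. t i = s i}"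
  have "openin seq_topology ?C"
    unfolding openin_seq_topology by (rule ballI, rule exI[of _ n]) auto
  moreover have "s \<in> ?C" by simp
  ultimately have "\<not> ?C \<subseteq> seq_topology closure_of S"
    using assms interior_of_maximal[of ?C _ seq_topology] unfolding nowhere_dense_in_def by blast
  then obtain t where t: "t \<in> ?C" "t \<in> - (seq_topology closure_of S)" by blast
  have "openin seq_topology (- (seq_topology closure_of S))"
    using closedin_closure_of[of seq_topology S] by (simp add: closedin_def Compl_eq_Diff_UNIV)
  then obtain m where m: "\<And>y. (\<forall>i<m. y i = t i) \<Longrightarrow> y \<in> - (seq_topology closure_of S)"
    using t(2) unfolding openin_seq_topology by blast
  \<comment> \<open>The point \<open>t\<close> lies off the closure of \<open>S\<close>, so an
    initial segment of it already excludes \<open>S\<close>; the maximum keeps this segment at least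
    as long as \<open>n\<close>.\<close>
  have "\<exists>i<max n m. x i \<noteq> t i" if "x \<in> S" for x
    using m[of x] that closure_of_subset[of S seq_topology] by fastforce
  then show thesis using that[of "max n m" t] t(1) by auto
qed

text \<open>One continuation \<open>z\<close> serves all prefixes \<open>s\<close> at once: over a
  finite alphabet there are finitely many prefixes of length \<open>n\<close>. They are treated one
  after another, each time lengthening the block by \<open>nowhere_dense_cylinder\<close>, which
  preserves what was achieved before.\<close>

lemma nowhere_dense_block:
  fixes N :: "nat \<Rightarrow> (nat \<Rightarrow> 'c::finite) set"
  assumes "\<And>k. nowhere_dense_in seq_topology (N k)"
  shows "\<exists>m>n. \<exists>z. \<forall>s. \<forall>k\<le>n. \<forall>x\<in>N k. \<exists>i<m. x i \<noteq> (if i < n then s i else z i)"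
proof -
  have "\<exists>m\<ge>n. \<exists>z. \<forall>(s,k)\<in>W. \<forall>x\<in>N k. \<exists>i<m. x i \<noteq> (if i < n then s i else z i)"
    if "finite W" for W
    using that
  proof (induction W)
    case empty
    show ?case by auto
  next
    case (insert w W)
    obtain s k where w: "w = (s, k)" by force
    obtain m z where m: "n \<le> m"
      and z: "\<And>s k x. (s, k) \<in> W \<Longrightarrow> x \<in> N k \<Longrightarrow> \<exists>i<m. x i \<noteq> (if i < n then s i else z i)"
      using insert.IH by blast
    obtain t m' where t: "m \<le> m'" "\<And>i. i < m \<Longrightarrow> t i = (if i < n then s i else z i)"
      "\<And>x. x \<in> N k \<Longrightarrow> \<exists>i<m'. x i \<noteq> t i"
      by (rule nowhere_dense_cylinder[OF assms[of k], of m "\<lambda>i. if i < n then s i else z i"]) blast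
    have "\<exists>i<m'. x i \<noteq> (if i < n then s' i else t i)"
      if h: "(s', k') \<in> insert w W" "x \<in> N k'" for s' k' x
    proof (cases "(s', k') = w")
      case True
      then obtain i where "i < m'" "x i \<noteq> t i" using t(3) h w by blast
      then show ?thesis using True t(2)[of i] m w by (intro exI[of _ i]) auto
    next
      case False
      then obtain i where "i < m" "x i \<noteq> (if i < n then s' i else z i)" using z h by blast
      then show ?thesis using t(1,2) by (intro exI[of _ i]) auto
    qed
    then have "\<forall>(s,k)\<in>insert w W. \<forall>x\<in>N k. \<exists>i<m'. x i \<noteq> (if i < n then s i else t i)"
      by blast
    then show ?case using m t(1) order_trans by blast
  qed
  \<comment> \<open>Only the values of \<open>s\<close> below \<open>n\<close> matter; restricting
    \<open>s\<close> to them leaves finitely many pairs.\<close>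
  from this[of "(\<Pi>\<^sub>E i\<in>{..<n}. UNIV) \<times> {..n}"]
  have "\<exists>m\<ge>n. \<exists>z. \<forall>(s,k)\<in>(\<Pi>\<^sub>E i\<in>{..<n}. UNIV) \<times> {..n}. \<forall>x\<in>N k.
      \<exists>i<m. x i \<noteq> (if i < n then s i else z i)"
    by (simp add: finite_PiE)
  then obtain m z where m: "n \<le> m"
    and z0: "\<forall>(s,k)\<in>(\<Pi>\<^sub>E i\<in>{..<n}. UNIV) \<times> {..n}. \<forall>x\<in>N k.
      \<exists>i<m. x i \<noteq> (if i < n then s i else z i)"
    by blast
  have z: "\<exists>i<m. x i \<noteq> (if i < n then s i else z i)"
    if "s \<in> (\<Pi>\<^sub>E i\<in>{..<n}. UNIV)" "k \<le> n" "x \<in> N k" for s k x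
    using z0 that by blast
  \<comment> \<open>\<open>Suc m\<close> in place of \<open>m\<close> makes the block nonempty, so
    that the block ends will increase strictly.\<close>
  have "\<exists>i<Suc m. x i \<noteq> (if i < n then s i else z i)" if kx: "k \<le> n" "x \<in> N k" for s k x
  proof -
    obtain i where "i < m" "x i \<noteq> (if i < n then restrict s {..<n} i else z i)"
      using z[OF _ kx, of "restrict s {..<n}"] by auto
    then show ?thesis by (intro exI[of _ i]) (auto split: if_splits)
  qed
  then show ?thesis using m by (intro exI[of _ "Suc m"] conjI exI[of _ z]) auto
qed

text \<open>Positions below \<open>l 0\<close>, if any, get index 0; \<open>block_index_eq\<close>
  speaks only of positions inside a block.\<close>

definition block_index :: "(nat \<Rightarrow> nat) \<Rightarrow> nat \<Rightarrow> nat" where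
  "block_index l i = (LEAST j. i < l (Suc j))"

lemma block_index_eq:
  assumes "strict_mono l" "l j \<le> i" "i < l (Suc j)"
  shows "block_index l i = j"
  unfolding block_index_def
proof (rule Least_equality)
  fix j' assume "i < l (Suc j')"
  then have "l j < l (Suc j')" using assms(2) by simp
  then show "j \<le> j'" using strict_mono_less[OF assms(1)] by simp
qed (use assms in auto)

text \<open>The classical description of meager sets by interval partitions. Block \<open>j\<close>
  of \<open>z\<close> excludes \<open>N k\<close> for every \<open>k \<le> l j\<close>, whatever
  precedes it. Since \<open>k \<le> j \<le> l j\<close> for late \<open>j\<close>, a single late
  block of agreement keeps \<open>x\<close> out of \<open>N k\<close>.\<close>

lemma meager_blocks:
  fixes M :: "(nat \<Rightarrow> 'c::finite) set"
  assumes "meager_in seq_topology M"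
  obtains l z where "strict_mono l"
    "\<And>x. (\<And>k. \<exists>j\<ge>k. \<forall>i. l j \<le> i \<and> i < l (Suc j) \<longrightarrow> x i = z i) \<Longrightarrow> x \<notin> M"
proof -
  obtain N where "\<forall>k::nat. nowhere_dense_in seq_topology (N k)" and M: "M = (\<Union>k. N k)"
    using assms unfolding meager_in_def by (elim exE conjE)
  then have N: "nowhere_dense_in seq_topology (N k)" for k by blast
  let ?Q = "\<lambda>n m z. \<forall>s. \<forall>k\<le>n. \<forall>x\<in>N k. \<exists>i<m. x i \<noteq> (if i < n then s i else z i)"
  have "\<forall>n. \<exists>m. n < m \<and> (\<exists>z. ?Q n m z)"
    by (rule allI, rule nowhere_dense_block[OF N])
  then obtain m where m: "\<And>n. n < m n" and "\<forall>n. \<exists>z. ?Q n (m n) z"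
    by (auto dest!: choice)
  then obtain y where y: "\<And>n. ?Q n (m n) (y n)"
    by (auto dest!: choice)
  define l where "l j = (m ^^ j) 0" for j
  have l_Suc: "l (Suc j) = m (l j)" for j by (simp add: l_def)
  have mono: "strict_mono l" by (rule strict_monoI_Suc) (simp add: l_Suc m)
  define z where "z i = y (l (block_index l i)) i" for i
  have "x \<notin> M" if x: "\<And>k. \<exists>j\<ge>k. \<forall>i. l j \<le> i \<and> i < l (Suc j) \<longrightarrow> x i = z i" for x
  proof
    assume "x \<in> M"
    then obtain k where k: "x \<in> N k" using M by blast
    obtain j where j: "j \<ge> k" "\<And>i. l j \<le> i \<Longrightarrow> i < l (Suc j) \<Longrightarrow> x i = z i" using x by blast
    have "k \<le> l j" using j(1) strict_mono_imp_increasing[OF mono, of j] by simp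
    then obtain i where i: "i < l (Suc j)" "x i \<noteq> (if i < l j then x i else y (l j) i)"
      using y[of "l j"] \<open>k \<le> l j\<close> k unfolding l_Suc by blast
    then have "l j \<le> i" by (auto split: if_splits)
    then show False using i j(2)[of i] block_index_eq[OF mono, of j i] by (simp add: z_def)
  qed
  then show thesis using mono that by blast
qed

text \<open>The open set that agrees with \<open>E\<close> modulo a meager set must be empty:
  otherwise it contains a point of \<open>E\<close> whose flip at some coordinate is still in that
  open set, still off the meager set, and hence in \<open>E\<close>.\<close>

lemma meager_if_flip:
  fixes E :: "(nat \<Rightarrow> bool \<times> bool) set"
  assumes E: "baire_property seq_topology E"
    and flip: "\<And>x n. x \<in> E \<Longrightarrow> x(n := (fst (x n), \<not> snd (x n))) \<notin> E"
  shows "meager_in seq_topology E"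
proof -
  obtain U where U: "openin seq_topology U" and M: "meager_in seq_topology ((E - U) \<union> (U - E))"
    using E unfolding baire_property_def by blast
  have "U = {}"
  proof (rule ccontr)
    assume "U \<noteq> {}"
    then obtain u n where n: "\<And>y. (\<forall>i<n. y i = u i) \<Longrightarrow> y \<in> U"
      using U unfolding openin_seq_topology by blast
    obtain l z where l: "strict_mono l"
      and z: "\<And>x. (\<And>k. \<exists>j\<ge>k. \<forall>i. l j \<le> i \<and> i < l (Suc j) \<longrightarrow> x i = z i)
        \<Longrightarrow> x \<notin> (E - U) \<union> (U - E)"
      using meager_blocks[OF M] by blast
    \<comment> \<open>\<open>u\<close> below \<open>n\<close> secures membership in
      \<open>U\<close>, and \<open>z\<close> afterwards avoids the meager set. Coordinate
      \<open>n\<close> stays free, because blocks that start at \<open>Suc n\<close> or later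
      suffice.\<close>
    define x where "x i = (if i < n then u i else z i)" for i
    have *: "y \<in> E" if "\<And>i. i \<noteq> n \<Longrightarrow> y i = x i" for y
    proof -
      have "y \<in> U" by (rule n) (use that in \<open>auto simp: x_def\<close>)
      moreover have "y \<notin> (E - U) \<union> (U - E)"
      proof (rule z)
        fix k
        have "Suc n \<le> l (max k (Suc n))"
          using strict_mono_imp_increasing[OF l, of "max k (Suc n)"] by simp
        then show "\<exists>j\<ge>k. \<forall>i. l j \<le> i \<and> i < l (Suc j) \<longrightarrow> y i = z i"
          using that by (intro exI[of _ "max k (Suc n)"]) (auto simp: x_def)
      qed
      ultimately show ?thesis by blast
    qed
    show False using flip[OF *[of x], of n] *[of "x(n := (fst (x n), \<not> snd (x n)))"] by auto
  qed
  then show ?thesis using M by simp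
qed

text \<open>An explicit instance of Mycielski's theorem on meager equivalence relations. As
  \<open>z\<close> is a sequence of pairs, \<open>c A\<close> can copy its first or its second
  component on each block. Where \<open>A\<close> chooses the first and \<open>B\<close> the second,
  the pair of \<open>c A\<close> and \<open>c B\<close> coincides with \<open>z\<close>; infinitely
  many such blocks keep it out of the relation.\<close>

lemma continuum_many_classes:
  fixes R :: "(nat \<Rightarrow> bool) \<Rightarrow> (nat \<Rightarrow> bool) \<Rightarrow> bool"
  assumes R: "equivp R"
    and bp: "baire_property seq_topology {g. R (fst \<circ> g) (snd \<circ> g)}"
    and flip: "\<And>a n. \<not> R a (a(n := \<not> a n))"
  obtains c :: "nat set \<Rightarrow> nat \<Rightarrow> bool" where "\<And>A B. A \<noteq> B \<Longrightarrow> \<not> R (c A) (c B)"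
proof -
  have "meager_in seq_topology {g. R (fst \<circ> g) (snd \<circ> g)}"
  proof (rule meager_if_flip[OF bp], rule notI)
    fix g :: "nat \<Rightarrow> bool \<times> bool" and n
    let ?g' = "g(n := (fst (g n), \<not> snd (g n)))"
    assume "g \<in> {g. R (fst \<circ> g) (snd \<circ> g)}" "?g' \<in> {g. R (fst \<circ> g) (snd \<circ> g)}"
    moreover have "fst \<circ> ?g' = fst \<circ> g" "snd \<circ> ?g' = (snd \<circ> g)(n := \<not> (snd \<circ> g) n)"
      by (auto simp: fun_eq_iff)
    ultimately have "R (snd \<circ> g) ((snd \<circ> g)(n := \<not> (snd \<circ> g) n))"
      using R by (metis equivp_symp equivp_transp mem_Collect_eq)
    then show False using flip by blast
  qed
  then obtain l z where l: "strict_mono l"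
    and z: "\<And>g. (\<And>k. \<exists>j\<ge>k. \<forall>i. l j \<le> i \<and> i < l (Suc j) \<longrightarrow> g i = z i)
        \<Longrightarrow> g \<notin> {g. R (fst \<circ> g) (snd \<circ> g)}"
    by (rule meager_blocks) blast
  \<comment> \<open>Each question whether \<open>i \<in> A\<close> and its negation are asked in infinitely many blocks, so distinct sets
    receive opposite answers infinitely often, in either order.\<close>
  define b where "b A j = (let i = fst (prod_decode j) in even i \<longleftrightarrow> i div 2 \<in> A)"
    for A :: "nat set" and j
  define c where "c A n = (if b A (block_index l n) then fst (z n) else snd (z n))" for A n
  have "\<not> R (c A) (c B)" if "A \<noteq> B" for A B
  proof -
    obtain i where i: "i \<in> A \<longleftrightarrow> i \<notin> B" using \<open>A \<noteq> B\<close> by blast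
    \<comment> \<open>The parity is chosen so that \<open>A\<close> answers yes and \<open>B\<close>
      no, never the other way round.\<close>
    define i' where "i' = (if i \<in> A then 2 * i else 2 * i + 1)"
    have b: "b A (prod_encode (i', k))" "\<not> b B (prod_encode (i', k))" for k
      using i by (auto simp: b_def i'_def Let_def)
    let ?g = "\<lambda>n. (c A n, c B n)"
    have "?g \<notin> {g. R (fst \<circ> g) (snd \<circ> g)}"
    proof (rule z)
      fix k
      show "\<exists>j\<ge>k. \<forall>n. l j \<le> n \<and> n < l (Suc j) \<longrightarrow> (c A n, c B n) = z n"
        using b[of k] le_prod_encode_2[of k i'] block_index_eq[OF l]
        by (intro exI[of _ "prod_encode (i', k)"]) (auto simp: c_def)
    qed
    then show ?thesis by (simp add: comp_def)
  qed
  then show thesis using that by blast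
qed

section \<open>Transfer of the property of Baire\<close>

lemma homeomorphic_map_nowhere_dense_in:
  assumes h: "homeomorphic_map Z T h" and S: "nowhere_dense_in Z S"
  shows "nowhere_dense_in T (h ` S)"
proof -
  have "S \<subseteq> topspace Z"
    using S by (simp add: nowhere_dense_in_def)
  moreover from this have "T interior_of (T closure_of (h ` S)) = h ` (Z interior_of (Z closure_of S))"
    by (simp add: homeomorphic_map_closure_of[OF h]
        homeomorphic_map_interior_of[OF h closure_of_subset_topspace])
  moreover from \<open>S \<subseteq> topspace Z\<close> have "h ` S \<subseteq> topspace T"
    using homeomorphic_imp_surjective_map[OF h] by blast
  ultimately show ?thesis
    using S by (simp add: nowhere_dense_in_def)
qed

lemma homeomorphic_map_baire_property:
  assumes h: "homeomorphic_map Z T h" and A: "baire_property Z A"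
  shows "baire_property T (h ` A)"
proof -
  obtain U N where U: "openin Z U" and N: "\<And>n::nat. nowhere_dense_in Z (N n)"
    and eq: "(A - U) \<union> (U - A) = (\<Union>n. N n)" and A: "A \<subseteq> topspace Z"
    using A unfolding baire_property_def meager_in_def by metis
  have "(h ` A - h ` U) \<union> (h ` U - h ` A) = h ` ((A - U) \<union> (U - A))"
    using inj_on_image_set_diff[OF homeomorphic_imp_injective_map[OF h], of A U]
      inj_on_image_set_diff[OF homeomorphic_imp_injective_map[OF h], of U A] A openin_subset[OF U]
    by (auto simp: image_Un)
  also have "\<dots> = (\<Union>n. h ` N n)" unfolding eq by blast
  finally have "meager_in T ((h ` A - h ` U) \<union> (h ` U - h ` A))"
    unfolding meager_in_def using homeomorphic_map_nowhere_dense_in[OF h N]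
    by (intro exI[of _ "\<lambda>n. h ` N n"]) blast
  moreover have "openin T (h ` U)"
    using homeomorphic_map_openness[OF h openin_subset[OF U]] U by simp
  ultimately show ?thesis
    using A homeomorphic_imp_surjective_map[OF h] unfolding baire_property_def by blast
qed

text \<open>A pointclass is defined only for topologies on sets of reals. The map is therefore
  conjugated to copies of \<open>Z\<close> and \<open>W\<close>, closure under continuous preimages
  is applied there, and the Baire property is carried back to \<open>Z\<close>.\<close>

lemma continuous_preimage_baire_property:
  assumes P: "nice_pointclass P" "pointclass_has_BP P"
    and Z: "polish_topology Z" and W: "polish_topology W" and f: "continuous_map Z W f"
    and A: "in_pointclass P W A"
  shows "baire_property Z {z \<in> topspace Z. f z \<in> A}"
proof -
  obtain T :: "real topology" and h where T: "polish_topology T" and h: "homeomorphic_map Z T h"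
    using polish_topology_homeomorphic_real[OF Z] by blast
  obtain T' h' where A: "A \<subseteq> topspace W" and h': "homeomorphic_map W T' h'" and P': "h' ` A \<in> P T'"
    using A unfolding in_pointclass_def by blast
  have T': "polish_topology T'"
    using W h' homeomorphic_polish_topology homeomorphic_map_imp_homeomorphic_space by blast
  obtain k where k: "homeomorphic_maps Z T h k" using h homeomorphic_map_maps by blast
  have "continuous_map T T' (h' \<circ> f \<circ> k)"
    using k f h' by (meson continuous_map_compose homeomorphic_imp_continuous_map homeomorphic_maps_def)
  then have "{t \<in> topspace T. (h' \<circ> f \<circ> k) t \<in> h' ` A} \<in> P T"
    using P(1)[unfolded nice_pointclass_def, THEN conjunct2, THEN conjunct2, THEN conjunct2,
        THEN conjunct1, rule_format, OF conjI[OF T conjI[OF T' conjI]]] P' by blast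
  then have "baire_property T {t \<in> topspace T. (h' \<circ> f \<circ> k) t \<in> h' ` A}"
    using P(2) T unfolding pointclass_has_BP_def by blast
  then have "baire_property Z (k ` {t \<in> topspace T. (h' \<circ> f \<circ> k) t \<in> h' ` A})"
    using homeomorphic_map_baire_property[of T Z k] k[THEN homeomorphic_maps_sym[THEN iffD1]]
        homeomorphic_maps_imp_map[of T Z k h] by blast
  also have "k ` {t \<in> topspace T. (h' \<circ> f \<circ> k) t \<in> h' ` A}
      = k ` {t \<in> topspace T. f (k t) \<in> A}"
  proof -
    have "(h' \<circ> f \<circ> k) t \<in> h' ` A \<longleftrightarrow> f (k t) \<in> A" if "t \<in> topspace T" for t
    proof -
      have "f (k t) \<in> topspace W"
        using that k f unfolding homeomorphic_maps_def continuous_map_def by blast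
      then show ?thesis
        using homeomorphic_imp_injective_map[OF h'] A by (auto simp: inj_on_def)
    qed
    then show ?thesis by (metis (mono_tags, lifting) Collect_cong)
  qed
  also have "\<dots> = {z \<in> topspace Z. f z \<in> A}"
  proof -
    have "k t \<in> topspace Z" if "t \<in> topspace T" for t
      using k that unfolding homeomorphic_maps_def continuous_map_def by blast
    moreover have "h z \<in> topspace T \<and> k (h z) = z" if "z \<in> topspace Z" for z
      using k that unfolding homeomorphic_maps_def continuous_map_def by blast
    ultimately show ?thesis by (force simp: image_iff)
  qed
  finally show ?thesis .
qed

section \<open>The loop space is Polish\<close>

lemma mtopology_of_openin:
  "openin (mtopology_of m) U \<longleftrightarrow>
    U \<subseteq> mspace m \<and> (\<forall>p\<in>U. \<exists>e>0. \<forall>q\<in>mspace m. mdist m p q < e \<longrightarrow> q \<in> U)"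
proof -
  interpret Metric_space "mspace m" "mdist m" by simp
  have "mball p e \<subseteq> U \<longleftrightarrow> (\<forall>q\<in>mspace m. mdist m p q < e \<longrightarrow> q \<in> U)"
    if "U \<subseteq> mspace m" "p \<in> U" for p e
    using that by (auto simp: subset_iff)
  then show ?thesis
    unfolding mtopology_of_def openin_mtopology by (metis (no_types, lifting))
qed

text \<open>A Lebesgue number argument. Only \<open>a\<close> is confined to the compact set while
  \<open>b\<close> ranges over the whole space, as needed to compare a fixed map with arbitrary
  nearby maps.\<close>

lemma compactin_uniform_mdist:
  fixes m1 m2 :: "'a metric"
  assumes top: "mtopology_of m1 = mtopology_of m2" and K: "compactin (mtopology_of m1) K" and "e > 0"
  obtains \<delta> where "\<delta> > 0"
    "\<And>a b. a \<in> K \<Longrightarrow> b \<in> mspace m1 \<Longrightarrow> mdist m1 a b < \<delta> \<Longrightarrow> mdist m2 a b < e"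
proof -
  interpret M1: Metric_space "mspace m1" "mdist m1" by simp
  interpret M2: Metric_space "mspace m2" "mdist m2" by simp
  have sp: "mspace m1 = mspace m2" using arg_cong[OF top, of topspace] by simp
  have KM: "K \<subseteq> mspace m1" using compactin_subset_topspace[OF K] by simp
  have "\<exists>r>0. \<forall>b\<in>mspace m1. mdist m1 a b < r \<longrightarrow> mdist m2 a b < e/2" if "a \<in> K" for a
  proof -
    have a: "a \<in> mspace m1" using KM that by blast
    have "openin (mtopology_of m1) (M2.mball a (e/2))"
      unfolding top by (simp add: mtopology_of_def)
    moreover have "a \<in> M2.mball a (e/2)" using a sp \<open>e > 0\<close> by simp
    ultimately show ?thesis unfolding mtopology_of_openin by (force simp: sp)
  qed
  then obtain r where r: "\<And>a. a \<in> K \<Longrightarrow> r a > 0"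
    "\<And>a b. a \<in> K \<Longrightarrow> b \<in> mspace m1 \<Longrightarrow> mdist m1 a b < r a \<Longrightarrow> mdist m2 a b < e/2"
    by metis
  let ?B = "\<lambda>a. M1.mball a (r a / 2)"
  have "K \<subseteq> \<Union>(?B ` K)" using KM r(1) by fastforce
  moreover have "\<forall>U\<in>?B ` K. openin (mtopology_of m1) U" by (auto simp: mtopology_of_def)
  ultimately obtain F where "finite F" "F \<subseteq> ?B ` K" "K \<subseteq> \<Union>F"
    using K unfolding compactin_def by meson
  then obtain K0 where K0: "finite K0" "K0 \<subseteq> K" "K \<subseteq> \<Union>(?B ` K0)"
    using finite_subset_image[of F ?B K] by blast
  \<comment> \<open>The covering balls have half the radius \<open>r\<close>, so that both
    \<open>a\<close> and \<open>b\<close> fall within \<open>r c\<close> of one center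
    \<open>c\<close>. The entry 1 covers an empty \<open>K0\<close>.\<close>
  define \<delta> where "\<delta> = Min (insert 1 ((\<lambda>a. r a / 2) ` K0))"
  have "\<delta> > 0" using K0 r(1) by (auto simp: \<delta>_def)
  moreover have "mdist m2 a b < e" if ab: "a \<in> K" "b \<in> mspace m1" "mdist m1 a b < \<delta>" for a b
  proof -
    obtain c where c: "c \<in> K0" "mdist m1 c a < r c / 2" using K0(3) ab(1) by auto
    have in_M: "c \<in> mspace m1" "a \<in> mspace m1" using c K0(2) KM ab by auto
    have "\<delta> \<le> r c / 2" using c(1) K0(1) unfolding \<delta>_def by (intro Min_le) auto
    then have "mdist m1 c b < r c" using M1.triangle[of c a b] c in_M ab by linarith
    then have "mdist m2 c b < e/2" using r(2) c K0(2) ab by blast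
    moreover have "mdist m2 c a < e/2" using r c K0(2) in_M by (smt (verit) field_sum_of_halves subsetD)
    ultimately show ?thesis
      using M2.triangle[of a c b] M2.commute[of a c] in_M ab sp by auto
  qed
  ultimately show thesis using that by blast
qed

text \<open>The image of \<open>p\<close> is compact, so closeness in \<open>m1\<close> turns into
  closeness in \<open>m2\<close> with one bound for all points of \<open>Z\<close>.\<close>

lemma openin_cfunspace_cong:
  assumes Z: "compact_space Z" and top: "mtopology_of m1 = mtopology_of m2"
    and U: "openin (mtopology_of (cfunspace Z m2)) U"
  shows "openin (mtopology_of (cfunspace Z m1)) U"
  unfolding mtopology_of_openin
proof (intro conjI ballI)
  have sp: "mspace m1 = mspace m2" using arg_cong[OF top, of topspace] by simp
  have cf: "mspace (cfunspace Z m1) = mspace (cfunspace Z m2)"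
    using Z by (simp add: compactin_mspace_cfunspace compact_space_def sp top del: mspace_cfunspace)
  show "U \<subseteq> mspace (cfunspace Z m1)" using U unfolding mtopology_of_openin cf by blast
  fix p assume "p \<in> U"
  then obtain e where "e > 0"
    and e: "\<And>q. q \<in> mspace (cfunspace Z m2) \<Longrightarrow> mdist (cfunspace Z m2) p q < e \<Longrightarrow> q \<in> U"
    using U unfolding mtopology_of_openin by blast
  have p: "p \<in> mspace (cfunspace Z m1)" using \<open>p \<in> U\<close> U unfolding mtopology_of_openin cf by blast
  then have "continuous_map Z (mtopology_of m1) p" by simp
  then have K: "compactin (mtopology_of m1) (p ` topspace Z)"
    using Z image_compactin compact_space_def by blast
  obtain \<delta> where \<delta>: "\<delta> > 0"
    "\<And>a b. a \<in> p ` topspace Z \<Longrightarrow> b \<in> mspace m1 \<Longrightarrow> mdist m1 a b < \<delta> \<Longrightarrow> mdist m2 a b < e/2"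
    using compactin_uniform_mdist[OF top K, of "e/2"] \<open>e > 0\<close> by auto
  have "q \<in> U" if q: "q \<in> mspace (cfunspace Z m1)" "mdist (cfunspace Z m1) p q < \<delta>" for q
  proof (rule e)
    show "q \<in> mspace (cfunspace Z m2)" using q(1) unfolding cf .
    have "mdist m2 (p z) (q z) < e/2" if "z \<in> topspace Z" for z
    proof (rule \<delta>(2))
      show "mdist m1 (p z) (q z) < \<delta>"
        using cfunspace_mdist_lt[OF _ p q that] Z by (simp add: compact_space_def)
      show "q z \<in> mspace m1" using q(1) that by auto
    qed (use that in blast)
    then have "mdist (cfunspace Z m2) p q \<le> e/2"
      using \<open>e > 0\<close> by (intro mdist_cfunspace_le) (auto intro: less_imp_le)
    then show "mdist (cfunspace Z m2) p q < e" using \<open>e > 0\<close> by simp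
  qed
  then show "\<exists>\<delta>>0. \<forall>q\<in>mspace (cfunspace Z m1). mdist (cfunspace Z m1) p q < \<delta> \<longrightarrow> q \<in> U"
    using \<delta>(1) by blast
qed

text \<open>Allows the metric of \<open>X\<close> to be exchanged for a complete one without
  changing the topology of the function space.\<close>

lemma mtopology_of_cfunspace_cong:
  assumes "compact_space Z" "mtopology_of m1 = mtopology_of m2"
  shows "mtopology_of (cfunspace Z m1) = mtopology_of (cfunspace Z m2)"
  using openin_cfunspace_cong[of Z m1 m2] openin_cfunspace_cong[of Z m2 m1] assms
  by (auto simp: topology_eq)

lemma continuous_map_cfunspace_eval:
  assumes "z \<in> topspace Z"
  shows "continuous_map (mtopology_of (cfunspace Z m)) (mtopology_of m) (\<lambda>f. f z)"
proof -
  interpret M: Metric_space "mspace m" "mdist m" by simp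
  interpret F: Metric_space "mspace (cfunspace Z m)" "mdist (cfunspace Z m)"
    by (rule Metric_space_mspace_mdist)
  show ?thesis
    unfolding mtopology_of_def M.continuous_map_to_metric
  proof (intro ballI allI impI)
    fix p and e :: real assume p: "p \<in> topspace F.mtopology" and "e > 0"
    have "q z \<in> M.mball (p z) e" if "q \<in> F.mball p (e/2)" for q
    proof -
      have "mdist m (p z) (q z) \<le> e/2"
        using that assms mdist_cfunspace_imp_mdist_le[of p Z m q "e/2" z]
        by (simp add: less_imp_le del: mspace_cfunspace)
      moreover have "p \<in> mspace (cfunspace Z m)" "q \<in> mspace (cfunspace Z m)"
        using that by (simp_all del: mspace_cfunspace)
      then have "p z \<in> mspace m" "q z \<in> mspace m" using assms by auto
      ultimately show ?thesis using \<open>e > 0\<close> by simp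
    qed
    then show "\<exists>U. openin F.mtopology U \<and> p \<in> U \<and> (\<forall>q\<in>U. q z \<in> M.mball (p z) e)"
      using p \<open>e > 0\<close>
      by (intro exI[of _ "F.mball p (e/2)"]) (simp del: F.in_mball mspace_cfunspace)
  qed
qed

text \<open>The function space over a complete metric is complete, and the loops are closed in it as
  the preimage of \<open>x\<close> under the evaluations at 0 and 1.\<close>

lemma completely_metrizable_loop_space:
  assumes "completely_metrizable_space (top_of_set X)"
  shows "completely_metrizable_space (mtopology_of (loop_space X x))"
proof -
  let ?I = "top_of_set {0..1::real}"
  obtain M d where "Metric_space M d" and c: "Metric_space.mcomplete M d"
    and top: "top_of_set X = Metric_space.mtopology M d"
    using assms unfolding completely_metrizable_space_def by blast
  interpret M: Metric_space M d by fact
  let ?F = "cfunspace ?I M.Self"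
  have I: "compact_space ?I" by (simp add: compact_space_subtopology)
  have "completely_metrizable_space (mtopology_of ?F)"
    using M.mcomplete_cfunspace[OF c, of ?I]
    unfolding mtopology_of_def mcomplete_of_def
    using Metric_space.completely_metrizable_space_mtopology Metric_space_mspace_mdist by blast
  moreover have "mtopology_of ?F = mtopology_of (cfunspace ?I (submetric euclidean_metric X))"
  proof (rule mtopology_of_cfunspace_cong[OF I])
    have "mtopology_of (submetric euclidean_metric X) = top_of_set X"
      by (simp add: mtopology_of_submetric)
    then show "mtopology_of M.Self = mtopology_of (submetric euclidean_metric X)"
      unfolding top by (simp add: mtopology_of_def)
  qed
  moreover have "closedin (mtopology_of ?F) (topspace (mtopology_of ?F) \<inter> {p. p 0 = x \<and> p 1 = x})"
  proof -
    have e: "continuous_map (mtopology_of ?F) M.mtopology (\<lambda>f. f t)" if "t \<in> {0..1}" for t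
      using continuous_map_cfunspace_eval[of t ?I M.Self] that by (simp add: mtopology_of_def)
    \<comment> \<open>The intersection with \<open>M\<close> covers the case that \<open>x\<close>
      lies outside \<open>X\<close>.\<close>
    have cl: "closedin M.mtopology ({x} \<inter> M)"
      using M.Hausdorff_space_mtopology by (cases "x \<in> M") (auto simp: closedin_Hausdorff_sing_eq)
    have "topspace (mtopology_of ?F) \<inter> {p. p 0 = x \<and> p 1 = x} =
      {p \<in> topspace (mtopology_of ?F). p 0 \<in> {x} \<inter> M} \<inter> {p \<in> topspace (mtopology_of ?F). p 1 \<in> {x} \<inter> M}"
      by auto
    also have "closedin (mtopology_of ?F) \<dots>"
      by (intro closedin_Int closedin_continuous_map_preimage[OF e cl]) auto
    finally show ?thesis .
  qed
  ultimately have "completely_metrizable_space (subtopology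
      (mtopology_of (cfunspace ?I (submetric euclidean_metric X))) {p. p 0 = x \<and> p 1 = x})"
    by (subst subtopology_restrict[symmetric]) (simp add: completely_metrizable_space_closedin)
  then show ?thesis
    by (simp add: loop_space_def mtopology_of_submetric)
qed

section \<open>Pointwise description of the loop space\<close>

lemma mspace_loop_space_imp_cfunspace:
  "p \<in> loops X x \<Longrightarrow> p \<in> mspace (cfunspace (top_of_set {0..1}) (submetric euclidean_metric X))"
  by (simp add: loop_space_def del: mspace_cfunspace)

lemma mdist_loop_space_le_iff:
  assumes "p \<in> loops X x" "q \<in> loops X x"
  shows "mdist (loop_space X x) p q \<le> e \<longleftrightarrow> (\<forall>t\<in>{0..1}. dist (p t) (q t) \<le> e)"
  using assms[THEN mspace_loop_space_imp_cfunspace]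
  by (simp add: loop_space_def cfunspace_mdist_le del: mspace_cfunspace)

text \<open>Pointwise bounds control the sup distance only in non-strict form, hence the passage to
  \<open>e/2\<close>. From here on closeness of loops is measured pointwise.\<close>

lemma openin_loop_space:
  "openin (mtopology_of (loop_space X x)) U \<longleftrightarrow> U \<subseteq> loops X x \<and>
    (\<forall>p\<in>U. \<exists>e>0. \<forall>q\<in>loops X x. (\<forall>t\<in>{0..1}. dist (p t) (q t) < e) \<longrightarrow> q \<in> U)"
proof -
  have *: "(\<exists>e>0. \<forall>q\<in>loops X x. mdist (loop_space X x) p q < e \<longrightarrow> q \<in> U)
    \<longleftrightarrow> (\<exists>e>0. \<forall>q\<in>loops X x. (\<forall>t\<in>{0..1}. dist (p t) (q t) < e) \<longrightarrow> q \<in> U)" (is "?l \<longleftrightarrow> ?r")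
    if p: "p \<in> loops X x" for p
  proof
    assume ?l
    then obtain e where e: "e > 0" "\<And>q. q \<in> loops X x \<Longrightarrow> mdist (loop_space X x) p q < e \<Longrightarrow> q \<in> U"
      by blast
    have "q \<in> U" if q: "q \<in> loops X x" "\<forall>t\<in>{0..1}. dist (p t) (q t) < e/2" for q
      using mdist_loop_space_le_iff[OF p q(1), of "e/2"] q e by (auto simp: less_imp_le)
    then show ?r using e(1) half_gt_zero by blast
  next
    assume ?r
    then obtain e where e: "e > 0"
      "\<And>q. q \<in> loops X x \<Longrightarrow> \<forall>t\<in>{0..1}. dist (p t) (q t) < e \<Longrightarrow> q \<in> U"
      by blast
    have "q \<in> U" if q: "q \<in> loops X x" "mdist (loop_space X x) p q < e" for q
      using mdist_loop_space_le_iff[OF p q(1), of "mdist (loop_space X x) p q"] q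
      by (intro e(2)) auto
    then show ?l using e(1) by blast
  qed
  show ?thesis
    unfolding mtopology_of_openin
  proof (intro conj_cong ball_cong refl)
    fix p assume "U \<subseteq> loops X x" "p \<in> U"
    then have "p \<in> loops X x" by blast
    then show "(\<exists>e>0. \<forall>q\<in>loops X x. mdist (loop_space X x) p q < e \<longrightarrow> q \<in> U)
      \<longleftrightarrow> (\<exists>e>0. \<forall>q\<in>loops X x. (\<forall>t\<in>{0..1}. dist (p t) (q t) < e) \<longrightarrow> q \<in> U)"
      by (rule *)
  qed
qed

lemma continuous_map_loop_spaceI:
  assumes "\<And>z. z \<in> topspace Z \<Longrightarrow> f z \<in> loops X x"
    and "\<And>z e. z \<in> topspace Z \<Longrightarrow> e > 0 \<Longrightarrow>
      \<exists>U. openin Z U \<and> z \<in> U \<and> (\<forall>w\<in>U. \<forall>t\<in>{0..1}. dist (f z t) (f w t) < e)"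
  shows "continuous_map Z (mtopology_of (loop_space X x)) f"
  unfolding continuous_map_def
proof (intro conjI allI impI)
  fix V assume V: "openin (mtopology_of (loop_space X x)) V"
  show "openin Z {z \<in> topspace Z. f z \<in> V}"
  proof (subst openin_subopen, intro ballI)
    fix z assume z: "z \<in> {z \<in> topspace Z. f z \<in> V}"
    then obtain e where e: "e > 0"
      "\<And>q. q \<in> loops X x \<Longrightarrow> \<forall>t\<in>{0..1}. dist (f z t) (q t) < e \<Longrightarrow> q \<in> V"
      using V unfolding openin_loop_space by blast
    obtain U where U: "openin Z U" "z \<in> U" "\<forall>w\<in>U. \<forall>t\<in>{0..1}. dist (f z t) (f w t) < e"
      using assms(2)[of z e] z e(1) by blast
    have "U \<subseteq> {z \<in> topspace Z. f z \<in> V}"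
      using U openin_subset[OF U(1)] assms(1) e(2) by blast
    then show "\<exists>T. openin Z T \<and> z \<in> T \<and> T \<subseteq> {z \<in> topspace Z. f z \<in> V}" using U by blast
  qed
qed (use assms(1) in simp)

text \<open>A general metric space offers no polygons as approximants. Loops are sorted instead by
  finite data: which points of a countable dense set they follow, on how many intervals, and how
  closely. One loop is chosen for each choice of data that occurs.\<close>

lemma separable_loop_space:
  assumes "separable_space (top_of_set X)"
  shows "separable_space (mtopology_of (loop_space X x))"
proof -
  obtain C where C: "countable C" "C \<subseteq> X" "top_of_set X closure_of C = X"
    using assms unfolding separable_space_def by auto
  have C_dense: "\<exists>c\<in>C. dist y c < e" if "y \<in> X" "e > 0" for y e
  proof -
    have "openin (top_of_set X) (X \<inter> ball y e)" by (simp add: openin_open_Int)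
    moreover have "y \<in> X \<inter> ball y e" "y \<in> top_of_set X closure_of C" using that C(3) by auto
    ultimately obtain c where "c \<in> C" "c \<in> X \<inter> ball y e" unfolding in_closure_of by blast
    then show ?thesis by auto
  qed
  define S where "S = (\<lambda>(cs, n, k). {p \<in> loops X x. \<forall>t\<in>{0..1}.
      dist (p t) (cs ! nat \<lfloor>t * real n\<rfloor>) < 1 / real (Suc k)})"
  define J where "J = lists C \<times> (UNIV :: nat set) \<times> (UNIV :: nat set)"
  define D where "D = (\<lambda>j. SOME p. p \<in> S j) ` {j \<in> J. S j \<noteq> {}}"
  have "countable J" unfolding J_def using C(1) by (intro countable_SIGMA) auto
  then have "countable D" unfolding D_def by (auto intro: countable_image countable_subset[of _ J])
  have D_S: "\<exists>q\<in>D. q \<in> S j" if "j \<in> J" "p \<in> S j" for j p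
  proof -
    have "(SOME p. p \<in> S j) \<in> S j" using that by (auto simp: some_in_eq)
    moreover have "(SOME p. p \<in> S j) \<in> D" using that unfolding D_def by blast
    ultimately show ?thesis by blast
  qed
  have "D \<subseteq> loops X x"
  proof
    fix q assume "q \<in> D"
    then obtain j where "S j \<noteq> {}" "q = (SOME p. p \<in> S j)" unfolding D_def by blast
    then have "q \<in> S j" by (simp add: some_in_eq)
    then show "q \<in> loops X x" by (auto simp: S_def split: prod.splits)
  qed
  moreover have "p \<in> mtopology_of (loop_space X x) closure_of D" if p: "p \<in> loops X x" for p
    unfolding in_closure_of
  proof (intro conjI allI impI)
    fix T assume T: "p \<in> T \<and> openin (mtopology_of (loop_space X x)) T"
    then obtain e where "e > 0"
      and e: "\<And>q. q \<in> loops X x \<Longrightarrow> (\<forall>t\<in>{0..1}. dist (p t) (q t) < e) \<Longrightarrow> q \<in> T"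
      unfolding openin_loop_space by blast
    \<comment> \<open>Two loops in the same \<open>S (cs, n, k)\<close> differ by less than twice
      \<open>1 / real (Suc k)\<close>.\<close>
    obtain k where k: "1 / real (Suc k) < e/2" using nat_approx_posE[of "e/2"] \<open>e > 0\<close> by auto
    define r where "r = 1 / real (Suc k)"
    have "r > 0" by (simp add: r_def)
    have pX: "p t \<in> X" if "t \<in> {0..1}" for t
      using p that by (auto simp: loops_iff path_image_def)
    have "uniformly_continuous_on {0..1} p"
      using p by (intro compact_uniformly_continuous) (auto simp: loops_iff path_def)
    then obtain d where d: "d > 0"
      "\<And>s t. s \<in> {0..1} \<Longrightarrow> t \<in> {0..1} \<Longrightarrow> dist s t < d \<Longrightarrow> dist (p s) (p t) < r/2"
      unfolding uniformly_continuous_on_def using \<open>r > 0\<close> half_gt_zero by metis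
    obtain m where m: "1 / real (Suc m) < d" using nat_approx_posE[OF d(1)] by blast
    define n where "n = Suc m"
    have n: "n > 0" "1 / real n < d" using m by (auto simp: n_def)
    have "\<exists>c\<in>C. dist (p (real i / real n)) c < r/2" if "i \<le> n" for i
      using that \<open>r > 0\<close> n by (intro C_dense pX) auto
    then obtain c where c: "\<And>i. i \<le> n \<Longrightarrow> c i \<in> C"
      "\<And>i. i \<le> n \<Longrightarrow> dist (p (real i / real n)) (c i) < r/2"
      by metis
    \<comment> \<open>There are \<open>n + 1\<close> entries, because the floor reaches
      \<open>n\<close> at \<open>t = 1\<close>.\<close>
    define cs where "cs = map c [0..<Suc n]"
    have "dist (p t) (cs ! nat \<lfloor>t * real n\<rfloor>) < r" if t: "t \<in> {0..1}" for t
    proof -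
      define i where "i = nat \<lfloor>t * real n\<rfloor>"
      have "0 \<le> t * real n" "t * real n \<le> real n" using t by (auto simp: mult_left_le_one_le)
      then have fl: "real i \<le> t * real n" "t * real n < real i + 1" "i \<le> n"
        unfolding i_def by (linarith | simp add: floor_le_iff nat_le_iff)+
      have "dist (real i / real n) t \<le> 1 / real n"
      proof -
        have "real i / real n \<le> t" "t < (real i + 1) / real n"
          using fl n(1) by (simp_all add: field_simps)
        then show ?thesis by (simp add: dist_real_def add_divide_distrib)
      qed
      moreover have "real i / real n \<in> {0..1}" using fl(3) n(1) by auto
      ultimately have "dist (p (real i / real n)) (p t) < r/2" using d(2) t n(2) by fastforce
      moreover have "cs ! i = c i" using fl(3) by (simp add: cs_def del: upt_Suc)
      ultimately show ?thesis
        using c(2)[OF fl(3)] dist_triangle[of "p t" "c i" "p (real i / real n)"]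
        unfolding i_def[symmetric] by (simp add: dist_commute)
    qed
    then have "p \<in> S (cs, n, k)" using p by (simp add: S_def r_def)
    moreover have "(cs, n, k) \<in> J" using c(1) by (auto simp: J_def cs_def)
    ultimately obtain q where q: "q \<in> D" "q \<in> S (cs, n, k)" using D_S by blast
    have "q \<in> T"
    proof (rule e)
      show "q \<in> loops X x" using q(2) by (simp add: S_def)
      show "\<forall>t\<in>{0..1}. dist (p t) (q t) < e"
      proof
        fix t :: real assume "t \<in> {0..1}"
        then have "dist (p t) (cs ! nat \<lfloor>t * real n\<rfloor>) < r" "dist (q t) (cs ! nat \<lfloor>t * real n\<rfloor>) < r"
          using q(2) \<open>p \<in> S (cs, n, k)\<close> by (auto simp: S_def r_def)
        then show "dist (p t) (q t) < e"
          using dist_triangle2[of "p t" "q t" "cs ! nat \<lfloor>t * real n\<rfloor>"] k unfolding r_def by linarith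
      qed
    qed
    then show "\<exists>q. q \<in> D \<and> q \<in> T" using q(1) by blast
  qed (use p in simp)
  ultimately show ?thesis
    unfolding separable_space_def using \<open>countable D\<close> closure_of_subset_topspace
    by (intro exI[of _ D]) fastforce
qed

lemma polish_loop_space:
  "polish_topology (top_of_set X) \<Longrightarrow> polish_topology (mtopology_of (loop_space X x))"
  by (simp add: polish_topology_def completely_metrizable_loop_space separable_loop_space)

section \<open>Infinite concatenation of loops\<close>

text \<open>The \<open>n\<close>-th loop is run through on \<open>[1 - 1/2^n, 1 - 1/2^(n+1)]\<close>.\<close>

definition inf_concat :: "'a \<Rightarrow> (nat \<Rightarrow> real \<Rightarrow> 'a) \<Rightarrow> real \<Rightarrow> 'a" where
  "inf_concat z s t = (if t < 1
     then let n = (LEAST n. t \<le> 1 - (1/2) ^ Suc n) in s n (2 ^ Suc n * t - 2 ^ Suc n + 2)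
     else z)"

lemma ex_dyadic_below_1:
  fixes t :: real assumes "t < 1" shows "\<exists>n. t \<le> 1 - (1/2) ^ Suc n"
proof -
  obtain n where "(1/2) ^ n < 1 - t"
    using real_arch_pow_inv[of "1 - t" "1/2"] assms by auto
  moreover have "(1/2::real) ^ Suc n \<le> (1/2) ^ n" by simp
  ultimately show ?thesis by (intro exI[of _ n]) linarith
qed

text \<open>The rescaling \<open>2 * t - 1\<close> lowers the dyadic index by one. The equality
  holds on the whole real line, so it can be substituted in inductions.\<close>

lemma inf_concat_join: "inf_concat z s = s 0 +++ inf_concat z (\<lambda>n. s (Suc n))"
proof
  fix t :: real
  show "inf_concat z s t = (s 0 +++ inf_concat z (\<lambda>n. s (Suc n))) t"
  proof (cases "t \<le> 1/2")
    case True
    then have "(LEAST n. t \<le> 1 - (1/2) ^ Suc n) = 0" by (intro Least_eq_0) simp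
    then show ?thesis using True by (simp add: inf_concat_def joinpaths_def)
  next
    case False
    show ?thesis
    proof (cases "t < 1")
      case True
      obtain n0 where "t \<le> 1 - (1/2) ^ Suc n0" using ex_dyadic_below_1[OF True] by blast
      moreover have "\<not> t \<le> 1 - (1/2) ^ Suc 0" using False by simp
      ultimately have "(LEAST n. t \<le> 1 - (1/2) ^ Suc n) = Suc (LEAST n. t \<le> 1 - (1/2) ^ Suc (Suc n))"
        by (rule Least_Suc)
      also have "(\<lambda>n. t \<le> 1 - (1/2) ^ Suc (Suc n)) = (\<lambda>n. 2 * t - 1 \<le> 1 - (1/2) ^ Suc n)"
        by (auto simp: fun_eq_iff)
      finally show ?thesis
        using True False by (simp add: inf_concat_def joinpaths_def Let_def algebra_simps)
    qed (use False in \<open>simp add: inf_concat_def joinpaths_def\<close>)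
  qed
qed

text \<open>The quantifier over \<open>s\<close> stands innermost: \<open>n\<close> and
  \<open>u\<close> depend on \<open>t\<close> alone, which makes two concatenations comparable at
  the same time.\<close>

lemma inf_concat_cases:
  assumes "t \<in> {0..1}"
  shows "(\<forall>s. inf_concat z s t = z) \<or> (\<exists>n. \<exists>u\<in>{0..1}. \<forall>s. inf_concat z s t = s n u)"
proof (cases "t < 1")
  case True
  define n where "n = (LEAST n. t \<le> 1 - (1/2) ^ Suc n)"
  have "t \<le> 1 - (1/2) ^ Suc n"
    unfolding n_def using ex_dyadic_below_1[OF True] by (rule LeastI_ex)
  then have "2 ^ Suc n * t \<le> 2 ^ Suc n * (1 - (1/2) ^ Suc n)" by (intro mult_left_mono) auto
  also have "\<dots> = 2 ^ Suc n - 1" by (simp add: right_diff_distrib power_one_over)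
  finally have le: "2 ^ Suc n * t - 2 ^ Suc n + 2 \<le> 1" by simp
  have "1 - (1/2) ^ n \<le> t"
  proof (cases n)
    case 0
    then show ?thesis using assms by simp
  next
    case (Suc m)
    then have "m < n" by simp
    then have "\<not> t \<le> 1 - (1/2) ^ Suc m" unfolding n_def by (rule not_less_Least)
    then show ?thesis using Suc by simp
  qed
  then have "2 ^ Suc n * (1 - (1/2) ^ n) \<le> 2 ^ Suc n * t" by (intro mult_left_mono) auto
  moreover have "2 ^ Suc n * (1 - (1/2) ^ n) = (2 ^ Suc n - 2 :: real)"
    by (simp add: right_diff_distrib power_one_over)
  ultimately have "0 \<le> 2 ^ Suc n * t - 2 ^ Suc n + 2" by linarith
  then have "2 ^ Suc n * t - 2 ^ Suc n + 2 \<in> {0..1}" using le by simp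
  moreover have "inf_concat z s t = s n (2 ^ Suc n * t - 2 ^ Suc n + 2)" for s
    using True by (simp add: inf_concat_def n_def Let_def)
  ultimately show ?thesis by blast
qed (simp add: inf_concat_def)

lemma dist_inf_concat_le:
  assumes "\<And>n u. u \<in> {0..1} \<Longrightarrow> dist (s n u) (s' n u) \<le> e" "0 \<le> e" "t \<in> {0..1}"
  shows "dist (inf_concat z s t) (inf_concat z s' t) \<le> e"
  using inf_concat_cases[OF assms(3), of z] assms(1,2) by (metis dist_self)

lemma inf_concat_in:
  assumes "\<And>n. path_image (s n) \<subseteq> X" "z \<in> X"
  shows "path_image (inf_concat z s) \<subseteq> X"
proof -
  have "inf_concat z s t \<in> X" if "t \<in> {0..1}" for t
    using inf_concat_cases[OF that, of z] assms unfolding path_image_def by (metis image_subset_iff)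
  then show ?thesis by (auto simp: path_image_def)
qed

lemma inf_concat_ends [simp]:
  "pathstart (inf_concat z s) = pathstart (s 0)" "pathfinish (inf_concat z s) = z"
  by (subst inf_concat_join, simp, simp add: inf_concat_def pathfinish_def)

lemma path_inf_concat_finite:
  assumes "\<And>n. path (s n)" "\<And>n. pathstart (s n) = z" "\<And>n. pathfinish (s n) = z"
    and "\<And>n. k \<le> n \<Longrightarrow> s n = (\<lambda>_. z)"
  shows "path (inf_concat z s)"
  using assms
proof (induction k arbitrary: s)
  case 0
  then have "s = (\<lambda>_ _. z)" by (simp add: fun_eq_iff)
  then have "inf_concat z s = (\<lambda>_. z)" by (simp add: inf_concat_def fun_eq_iff)
  then show ?case by (simp add: path_def)
next
  case (Suc k)
  have "path (inf_concat z (\<lambda>n. s (Suc n)))" by (rule Suc.IH) (use Suc.prems in auto)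
  then show ?case using Suc.prems by (subst inf_concat_join) simp
qed

text \<open>Truncations, with constant loops from \<open>k\<close> on, are finite concatenations and
  hence continuous. They converge uniformly because the loops shrink to \<open>z\<close>, which
  settles continuity at the end point 1 as well.\<close>

lemma path_inf_concat:
  fixes z :: "'a::metric_space"
  assumes s: "\<And>n. path (s n)" "\<And>n. pathstart (s n) = z" "\<And>n. pathfinish (s n) = z"
    and null: "\<And>e. e > 0 \<Longrightarrow> \<exists>k. \<forall>n\<ge>k. \<forall>t\<in>{0..1}. dist (s n t) z \<le> e"
  shows "path (inf_concat z s)"
proof -
  define c where "c k = inf_concat z (\<lambda>n. if n < k then s n else (\<lambda>_. z))" for k
  have "path (c k)" for k
    unfolding c_def
    by (rule path_inf_concat_finite[where k = k])
      (use s in \<open>auto simp: path_def pathstart_def pathfinish_def\<close>)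
  moreover have "uniform_limit {0..1} c (inf_concat z s) sequentially"
    unfolding uniform_limit_iff
  proof (intro allI impI)
    fix e :: real assume "e > 0"
    then obtain k where "\<forall>n\<ge>k. \<forall>t\<in>{0..1}. dist (s n t) z \<le> e/2"
      using null[OF half_gt_zero] by blast
    then have k: "dist (s n t) z \<le> e/2" if "n \<ge> k" "t \<in> {0..1}" for n t
      using that by blast
    have "dist (c m t) (inf_concat z s t) \<le> e/2" if "m \<ge> k" "t \<in> {0..1}" for m t
      unfolding c_def
      by (rule dist_inf_concat_le) (use that k \<open>e > 0\<close> in \<open>auto simp: dist_commute\<close>)
    then show "\<forall>\<^sub>F m in sequentially. \<forall>t\<in>{0..1}. dist (c m t) (inf_concat z s t) < e"
      unfolding eventually_sequentially using \<open>e > 0\<close> by (intro exI[of _ k]) force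
  qed
  ultimately show ?thesis
    unfolding path_def by (intro uniform_limit_theorem) auto
qed

text \<open>Loops that are not selected are replaced by constants rather than dropped. Every
  \<open>s n\<close> keeps its interval of time, so changing late digits moves the path only a
  little.\<close>

definition select_concat :: "'a \<Rightarrow> (nat \<Rightarrow> real \<Rightarrow> 'a) \<Rightarrow> (nat \<Rightarrow> bool) \<Rightarrow> real \<Rightarrow> 'a" where
  "select_concat z s a = inf_concat z (\<lambda>n. if a n then s n else (\<lambda>_. z))"

lemma select_concat_Suc:
  "select_concat z s a =
    (if a 0 then s 0 else (\<lambda>_. z)) +++ select_concat z (\<lambda>n. s (Suc n)) (\<lambda>n. a (Suc n))"
  unfolding select_concat_def by (subst inf_concat_join) rule

lemma select_concat_path:
  fixes z :: "'a::metric_space"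
  assumes s: "\<And>n. path (s n)" "\<And>n. pathstart (s n) = z" "\<And>n. pathfinish (s n) = z"
    and X: "\<And>n. path_image (s n) \<subseteq> X"
    and null: "\<And>e. e > 0 \<Longrightarrow> \<exists>k. \<forall>n\<ge>k. \<forall>t\<in>{0..1}. dist (s n t) z \<le> e"
  shows "path (select_concat z s a)" "path_image (select_concat z s a) \<subseteq> X"
    "pathstart (select_concat z s a) = z" "pathfinish (select_concat z s a) = z"
proof -
  have "z \<in> X" using X[of 0] s(2)[of 0] pathstart_in_path_image by fastforce
  have "\<exists>k. \<forall>n\<ge>k. \<forall>t\<in>{0..1}. dist ((if a n then s n else (\<lambda>_. z)) t) z \<le> e" if "e > 0" for e
    using null[OF that] that by (smt (verit) dist_self)
  then show "path (select_concat z s a)"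
    unfolding select_concat_def
    by (intro path_inf_concat) (use s in \<open>auto simp: path_def pathstart_def pathfinish_def\<close>)
  show "path_image (select_concat z s a) \<subseteq> X"
    unfolding select_concat_def
    by (rule inf_concat_in) (use X \<open>z \<in> X\<close> in \<open>auto simp: path_image_def\<close>)
  show "pathstart (select_concat z s a) = z" "pathfinish (select_concat z s a) = z"
    using s(2) by (simp_all add: select_concat_def) (simp add: pathstart_def)
qed

lemma select_concat_close:
  fixes z :: "'a::metric_space"
  assumes "\<And>n t. k \<le> n \<Longrightarrow> t \<in> {0..1} \<Longrightarrow> dist (s n t) z \<le> e" "0 \<le> e"
    and "\<And>n. n < k \<Longrightarrow> a n = b n" and "t \<in> {0..1}"
  shows "dist (select_concat z s a t) (select_concat z s b t) \<le> e"
  unfolding select_concat_def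
proof (rule dist_inf_concat_le)
  fix n and u :: real assume "u \<in> {0..1}"
  then show "dist ((if a n then s n else (\<lambda>_. z)) u) ((if b n then s n else (\<lambda>_. z)) u) \<le> e"
    using assms(1)[of n u] assms(2) assms(3)[of n] by (cases "n < k") (auto simp: dist_commute)
qed (use assms in auto)

lemma dist_joinpaths_le:
  fixes p q :: "real \<Rightarrow> 'a::metric_space"
  assumes "\<And>t. t \<in> {0..1} \<Longrightarrow> dist (p t) (p' t) \<le> e" "\<And>t. t \<in> {0..1} \<Longrightarrow> dist (q t) (q' t) \<le> e"
    and "t \<in> {0..1}"
  shows "dist ((p +++ q) t) ((p' +++ q') t) \<le> e"
  using assms by (auto simp: joinpaths_def)

lemma dist_reversepath_le:
  fixes p :: "real \<Rightarrow> 'a::metric_space"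
  assumes "\<And>t. t \<in> {0..1} \<Longrightarrow> dist (p t) (p' t) \<le> e" and "t \<in> {0..1}"
  shows "dist (reversepath p t) (reversepath p' t) \<le> e"
  using assms by (auto simp: reversepath_def)

section \<open>Holonomy modulo a normal subgroup\<close>

lemma pathstart_const [simp]: "pathstart (\<lambda>_. y) = y"
  and pathfinish_const [simp]: "pathfinish (\<lambda>_. y) = y"
  and reversepath_const [simp]: "reversepath (\<lambda>_. y) = (\<lambda>_. y)"
  by (simp_all add: pathstart_def pathfinish_def reversepath_def)

text \<open>Reversing paths reduces this to \<open>homotopic_paths_const_join\<close>.\<close>

lemma homotopic_paths_join_const:
  assumes "path p" "path_image p \<subseteq> X"
  shows "homotopic_paths X (p +++ (\<lambda>t. pathfinish p)) p"
proof -
  have "homotopic_paths X (reversepath (p +++ (\<lambda>t. pathfinish p))) (reversepath p)"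
    using homotopic_paths_const_join[of "reversepath p" X] assms
    by (subst reversepath_joinpaths) simp_all
  then show ?thesis by (simp only: homotopic_paths_reversepath)
qed

lemma homotopic_paths_cancel_left:
  assumes "path b" "path_image b \<subseteq> X" "path r" "path_image r \<subseteq> X" "pathstart r = pathfinish b"
  shows "homotopic_paths X (reversepath b +++ (b +++ r)) r"
proof -
  have "homotopic_paths X (reversepath b +++ (b +++ r)) ((reversepath b +++ b) +++ r)"
    using assms by (intro homotopic_paths_assoc) auto
  also have "homotopic_paths X ((reversepath b +++ b) +++ r) ((\<lambda>t. pathfinish b) +++ r)"
    using assms by (intro homotopic_paths_join homotopic_paths_reversepath_join) auto
  also have "homotopic_paths X ((\<lambda>t. pathfinish b) +++ r) r"
    using homotopic_paths_const_join[of r X] assms by simp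
  finally show ?thesis .
qed

locale loop_quotient =
  fixes X :: "'a::metric_space set" and x :: 'a and G :: "(real \<Rightarrow> 'a) set set"
  assumes path_connected: "path_connected X" and base_in: "x \<in> X"
    and normal: "G \<lhd> fundamental_group X x"
begin

declare one_FactGroup [simp del] mult_FactGroup [simp del]

abbreviation Q :: "(real \<Rightarrow> 'a) set set monoid" where
  "Q \<equiv> fundamental_group X x Mod G"

definition path_in :: "(real \<Rightarrow> 'a) \<Rightarrow> bool" where
  "path_in p \<longleftrightarrow> path p \<and> path_image p \<subseteq> X"

lemma path_in_join [simp]:
  "pathfinish p = pathstart q \<Longrightarrow> path_in p \<Longrightarrow> path_in q \<Longrightarrow> path_in (p +++ q)"
  by (simp add: path_in_def subset_path_image_join)

lemma path_in_reverse [simp]: "path_in (reversepath p) \<longleftrightarrow> path_in p"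
  by (simp add: path_in_def)

lemma path_in_const [simp]: "path_in (\<lambda>t. y) \<longleftrightarrow> y \<in> X"
  by (auto simp: path_in_def path_def path_image_def)

lemma path_in_ends: "path_in p \<Longrightarrow> pathstart p \<in> X" "path_in p \<Longrightarrow> pathfinish p \<in> X"
  unfolding path_in_def by (metis pathstart_in_path_image pathfinish_in_path_image subsetD)+

lemma loopsI:
  "path_in p \<Longrightarrow> pathstart p = x \<Longrightarrow> pathfinish p = x \<Longrightarrow> restrict p {0..1} \<in> loops X x"
  by (auto simp: path_in_def intro: restrict_loop)

lemma loopsD:
  assumes "p \<in> loops X x" shows "path_in p" "pathstart p = x" "pathfinish p = x" "restrict p {0..1} = p"
  using assms by (auto simp: path_in_def loops_iff extensional_restrict)

sublocale N: normal G "fundamental_group X x" by (rule normal)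

sublocale Q: group Q by (rule N.factorgroup_is_group)

section \<open>Homotopy classes of paths closed at the base point\<close>

definition loop_class :: "(real \<Rightarrow> 'a) \<Rightarrow> (real \<Rightarrow> 'a) set" where
  "loop_class p = loop_homotopy X x `` {restrict p {0..1}}"

lemma loop_class_eq:
  assumes "homotopic_paths X p q" "pathstart p = x" "pathfinish p = x"
  shows "loop_class p = loop_class q"
proof -
  have pq: "path_in p" "path_in q" "pathstart q = x" "pathfinish q = x"
    using homotopic_paths_imp_path[OF assms(1)] homotopic_paths_imp_subset[OF assms(1)]
      homotopic_paths_imp_pathstart[OF assms(1)] homotopic_paths_imp_pathfinish[OF assms(1)] assms(2,3)
    by (auto simp: path_in_def)
  then have "homotopic_paths X (restrict p {0..1}) (restrict q {0..1})"
    using assms unfolding path_in_def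
    by (intro homotopic_paths_trans[OF homotopic_paths_sym[OF restrict_loop(2)]
          homotopic_paths_trans[OF assms(1) restrict_loop(2)]]) auto
  then show ?thesis
    unfolding loop_class_def using pq assms
    by (intro equiv_class_eq[OF equiv_loop_homotopy]) (simp add: loop_homotopy_def loopsI)
qed

lemma carrier_loop_class: "carrier (fundamental_group X x) = loop_class ` loops X x"
  by (auto simp: fundamental_group_def quotient_def loop_class_def loopsD(4))

lemma loop_class_in:
  "path_in p \<Longrightarrow> pathstart p = x \<Longrightarrow> pathfinish p = x \<Longrightarrow> loop_class p \<in> carrier (fundamental_group X x)"
  unfolding carrier_loop_class using loopsI[of p] loopsD(4)[of "restrict p {0..1}"]
  by (metis image_eqI loop_class_def)

lemma loop_class_join:
  assumes p: "path_in p" "pathstart p = x" "pathfinish p = x"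
    and q: "path_in q" "pathstart q = x" "pathfinish q = x"
  shows "loop_class (p +++ q) = loop_class p \<otimes>\<^bsub>fundamental_group X x\<^esub> loop_class q"
proof -
  let ?p = "restrict p {0..1}" and ?q = "restrict q {0..1}"
  have "homotopic_paths X (p +++ q) (?p +++ ?q)"
    using p q by (intro homotopic_paths_join restrict_loop) (auto simp: path_in_def)
  then have "loop_class (p +++ q) = loop_class (?p +++ ?q)"
    using p q by (intro loop_class_eq) auto
  also have "\<dots> = loop_class p \<otimes>\<^bsub>fundamental_group X x\<^esub> loop_class q"
    unfolding loop_class_def
    by (rule fundamental_group_mult_class[symmetric]) (simp_all add: p q loopsI)
  finally show ?thesis .
qed

text \<open>Closing up paths along fixed paths from \<open>x\<close> turns the projection of the fundamental group onto
  \<open>\<pi>\<^sub>1(X)/G\<close> into a homomorphism defined on all paths in \<open>X\<close>.\<close>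

definition base_path :: "'a \<Rightarrow> real \<Rightarrow> 'a" where
  "base_path y = (if y = x then (\<lambda>_. x)
     else (SOME g. path_in g \<and> pathstart g = x \<and> pathfinish g = y))"

definition closed_up :: "(real \<Rightarrow> 'a) \<Rightarrow> real \<Rightarrow> 'a" where
  "closed_up p = base_path (pathstart p) +++ (p +++ reversepath (base_path (pathfinish p)))"

definition holonomy :: "(real \<Rightarrow> 'a) \<Rightarrow> (real \<Rightarrow> 'a) set set" where
  "holonomy p = G #>\<^bsub>fundamental_group X x\<^esub> loop_class (closed_up p)"

lemma base_path:
  assumes "y \<in> X"
  shows "path_in (base_path y)" "pathstart (base_path y) = x" "pathfinish (base_path y) = y"
proof -
  have "\<exists>g. path_in g \<and> pathstart g = x \<and> pathfinish g = y"
    using path_connected base_in assms unfolding path_connected_def path_in_def by metis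
  then have *: "path_in (base_path y) \<and> pathstart (base_path y) = x \<and> pathfinish (base_path y) = y"
  proof (cases "y = x")
    case True
    then show ?thesis using base_in by (simp add: base_path_def)
  next
    case False
    then show ?thesis using \<open>\<exists>g. _ g\<close> someI_ex[OF \<open>\<exists>g. _ g\<close>] by (simp add: base_path_def)
  qed
  then show "path_in (base_path y)" "pathstart (base_path y) = x" "pathfinish (base_path y) = y"
    by auto
qed

lemma closed_up:
  assumes "path_in p"
  shows "path_in (closed_up p)" "pathstart (closed_up p) = x" "pathfinish (closed_up p) = x"
  using assms base_path path_in_ends[OF assms] by (auto simp: closed_up_def)

lemma holonomy_in: "path_in p \<Longrightarrow> holonomy p \<in> carrier Q"
  using loop_class_in[OF closed_up] by (auto simp: holonomy_def FactGroup_def RCOSETS_def)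

lemma holonomy_homotopic:
  assumes "homotopic_paths X p q" shows "holonomy p = holonomy q"
proof -
  have p: "path_in p" and ends: "pathstart q = pathstart p" "pathfinish q = pathfinish p"
    using homotopic_paths_imp_path[OF assms] homotopic_paths_imp_subset[OF assms]
      homotopic_paths_imp_pathstart[OF assms] homotopic_paths_imp_pathfinish[OF assms]
    by (auto simp: path_in_def)
  have "homotopic_paths X (closed_up p) (closed_up q)"
    unfolding closed_up_def ends
    using base_path[OF path_in_ends(1)[OF p]] base_path[OF path_in_ends(2)[OF p]] assms
    by (intro homotopic_paths_join) (auto simp: path_in_def)
  then show ?thesis
    unfolding holonomy_def using loop_class_eq closed_up[OF p] by metis
qed

text \<open>The closing path \<open>b\<close> and its reverse meet in the middle and cancel; the
  rest is reassociation.\<close>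

lemma holonomy_join:
  assumes p: "path_in p" and q: "path_in q" and pq: "pathfinish p = pathstart q"
  shows "holonomy (p +++ q) = holonomy p \<otimes>\<^bsub>Q\<^esub> holonomy q"
proof -
  define a b c where abc: "a = base_path (pathstart p)" "b = base_path (pathstart q)"
    "c = base_path (pathfinish q)"
  note H = p q base_path[OF path_in_ends(1)[OF p], folded abc]
    base_path[OF path_in_ends(1)[OF q], folded abc] base_path[OF path_in_ends(2)[OF q], folded abc]
  have P: "path r" "path_image r \<subseteq> X" if "path_in r" for r using that by (auto simp: path_in_def)
  note HP = H H(1)[THEN P(1)] H(2)[THEN P(1)] H(3)[THEN P(1)] H(6)[THEN P(1)] H(9)[THEN P(1)]
    H(1)[THEN P(2)] H(2)[THEN P(2)] H(3)[THEN P(2)] H(6)[THEN P(2)] H(9)[THEN P(2)]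
  let ?q = "q +++ reversepath c"
  have 1: "homotopic_paths X ((a +++ (p +++ reversepath b)) +++ (b +++ ?q))
      (a +++ ((p +++ reversepath b) +++ (b +++ ?q)))"
    using HP pq by (intro homotopic_paths_sym[OF homotopic_paths_assoc]) (auto simp: subset_path_image_join)
  have 2: "homotopic_paths X ((p +++ reversepath b) +++ (b +++ ?q)) (p +++ (reversepath b +++ (b +++ ?q)))"
    using HP pq by (intro homotopic_paths_sym[OF homotopic_paths_assoc]) (auto simp: subset_path_image_join)
  have 3: "homotopic_paths X (p +++ (reversepath b +++ (b +++ ?q))) (p +++ ?q)"
    using HP pq by (intro homotopic_paths_join homotopic_paths_cancel_left) (auto simp: subset_path_image_join)
  have 4: "homotopic_paths X (p +++ ?q) ((p +++ q) +++ reversepath c)"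
    using HP pq by (intro homotopic_paths_assoc) auto
  have 5: "homotopic_paths X (a +++ ((p +++ reversepath b) +++ (b +++ ?q)))
      (a +++ ((p +++ q) +++ reversepath c))"
    using HP pq by (intro homotopic_paths_join homotopic_paths_trans[OF 2 homotopic_paths_trans[OF 3 4]]) auto
  have "homotopic_paths X (closed_up p +++ closed_up q) (closed_up (p +++ q))"
    using homotopic_paths_trans[OF 1 5] pq by (simp add: closed_up_def abc)
  then have "loop_class (closed_up (p +++ q)) = loop_class (closed_up p +++ closed_up q)"
    using closed_up[OF p] closed_up[OF q] by (intro loop_class_eq[symmetric]) auto
  also have "\<dots> = loop_class (closed_up p) \<otimes>\<^bsub>fundamental_group X x\<^esub> loop_class (closed_up q)"
    using closed_up[OF p] closed_up[OF q] by (rule loop_class_join)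
  finally show ?thesis
    using loop_class_in[OF closed_up[OF p]] loop_class_in[OF closed_up[OF q]]
    by (simp add: holonomy_def FactGroup_def N.rcos_sum)
qed

text \<open>A constant path concatenated with itself is unchanged, and an idempotent of a group is
  the identity.\<close>

lemma holonomy_const [simp]: "y \<in> X \<Longrightarrow> holonomy (\<lambda>_. y) = \<one>\<^bsub>Q\<^esub>"
proof -
  assume y: "y \<in> X"
  have "(\<lambda>_. y) +++ (\<lambda>_. y) = (\<lambda>_::real. y)" by (auto simp: joinpaths_def)
  then have "holonomy (\<lambda>_. y) = holonomy (\<lambda>_. y) \<otimes>\<^bsub>Q\<^esub> holonomy (\<lambda>_. y)"
    using holonomy_join[of "\<lambda>_. y" "\<lambda>_. y"] y by simp
  then show ?thesis using Q.l_cancel_one' holonomy_in[of "\<lambda>_. y"] y by simp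
qed

lemma holonomy_reverse:
  assumes "path_in p"
  shows "holonomy (reversepath p) = inv\<^bsub>Q\<^esub> holonomy p"
proof -
  have "holonomy (reversepath p) \<otimes>\<^bsub>Q\<^esub> holonomy p = holonomy (reversepath p +++ p)"
    using assms by (intro holonomy_join[symmetric]) auto
  also have "\<dots> = holonomy (\<lambda>_. pathfinish p)"
    using assms by (intro holonomy_homotopic homotopic_paths_reversepath_join) (auto simp: path_in_def)
  also have "\<dots> = \<one>\<^bsub>Q\<^esub>" using path_in_ends[OF assms] by simp
  finally show ?thesis
    using Q.inv_equality holonomy_in assms by (metis path_in_reverse)
qed

text \<open>\<open>base_path x\<close> is constant by definition, so closing up a loop at
  \<open>x\<close> adds only constant pieces.\<close>

lemma holonomy_loop:
  assumes "path_in p" "pathstart p = x" "pathfinish p = x"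
  shows "holonomy p = G #>\<^bsub>fundamental_group X x\<^esub> loop_class p"
proof -
  have "homotopic_paths X (p +++ (\<lambda>_. x)) p"
    using homotopic_paths_join_const[of p X] assms by (simp add: path_in_def)
  then have "homotopic_paths X ((\<lambda>_. x) +++ (p +++ (\<lambda>_. x))) ((\<lambda>_. x) +++ p)"
    using base_in assms
    by (intro homotopic_paths_join) (auto simp: path_image_def path_def)
  also have "homotopic_paths X ((\<lambda>_. x) +++ p) p"
    using homotopic_paths_const_join[of p X] assms by (simp add: path_in_def)
  finally have "loop_class ((\<lambda>_. x) +++ (p +++ (\<lambda>_. x))) = loop_class p"
    by (rule loop_class_eq) (simp_all add: assms)
  then show ?thesis
    using assms by (simp add: holonomy_def closed_up_def base_path_def)
qed

lemma carrier_Q: "carrier Q = holonomy ` loops X x"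
proof -
  have "carrier Q = (\<lambda>p. G #>\<^bsub>fundamental_group X x\<^esub> loop_class p) ` loops X x"
    by (auto simp: FactGroup_def RCOSETS_def carrier_loop_class)
  also have "\<dots> = holonomy ` loops X x"
    by (intro image_cong refl holonomy_loop[symmetric] loopsD)
  finally show ?thesis .
qed

text \<open>The bridge between the algebra of the quotient and the topology of the loop space, where
  only \<open>\<Union>G\<close> is visible. It rests on the elements of \<open>G\<close> being whole
  homotopy classes.\<close>

lemma holonomy_eq_one_iff:
  assumes "p \<in> loops X x"
  shows "holonomy p = \<one>\<^bsub>Q\<^esub> \<longleftrightarrow> p \<in> \<Union>G"
proof -
  have c: "loop_class p \<in> carrier (fundamental_group X x)"
    using assms by (intro loop_class_in loopsD)
  have "holonomy p = \<one>\<^bsub>Q\<^esub> \<longleftrightarrow> G #>\<^bsub>fundamental_group X x\<^esub> loop_class p = G"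
    using holonomy_loop[OF loopsD(1-3)[OF assms]] by (simp add: FactGroup_def)
  also have "\<dots> \<longleftrightarrow> loop_class p \<in> G"
    using N.coset_join1[OF _ c N.subgroup_axioms] N.coset_join2[OF c N.subgroup_axioms] by blast
  also have "\<dots> \<longleftrightarrow> p \<in> \<Union>G"
  proof
    have "p \<in> loop_class p"
      unfolding loop_class_def using assms equiv_class_self[OF equiv_loop_homotopy] by (simp add: loopsD(4))
    then show "loop_class p \<in> G \<Longrightarrow> p \<in> \<Union>G" by blast
  next
    assume "p \<in> \<Union>G"
    then obtain A where A: "A \<in> G" "p \<in> A" by blast
    then obtain q where "q \<in> loops X x" "A = loop_class q"
      using N.subset carrier_loop_class by blast
    then have "A = loop_class p"
      using A(2) equiv_class_eq[OF equiv_loop_homotopy, of q p X x]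
      by (auto simp: loop_class_def loopsD(4) assms)
    then show "loop_class p \<in> G" using A by simp
  qed
  finally show ?thesis .
qed

lemma Union_subset_loops: "\<Union>G \<subseteq> loops X x"
  using N.subset by (auto simp: carrier_loop_class loop_class_def loop_homotopy_def)

lemma holonomy_restrict:
  assumes "path_in p" shows "holonomy (restrict p {0..1}) = holonomy p"
  using assms
  by (intro holonomy_homotopic[symmetric] homotopic_paths_eq) (auto simp: path_in_def)

end

section \<open>Small loops outside a subgroup that is not open\<close>

lemma locally_path_connected_ball:
  fixes X :: "'a::metric_space set"
  assumes "locally path_connected X" "z \<in> X" "e > 0"
  shows "\<exists>r>0. \<forall>y\<in>X. dist z y < r \<longrightarrow>
    (\<exists>c. path c \<and> path_image c \<subseteq> X \<inter> ball z e \<and> pathstart c = z \<and> pathfinish c = y)"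
proof -
  have "openin (top_of_set X) (X \<inter> ball z e)" by (simp add: openin_open_Int)
  then obtain U where U: "openin (top_of_set X) U" "path_connected U" "z \<in> U" "U \<subseteq> X \<inter> ball z e"
    using assms locally_path_connected[of X] by (meson IntI centre_in_ball)
  obtain r where "r > 0" "\<forall>y\<in>X. dist y z < r \<longrightarrow> y \<in> U"
    using U(1,3) unfolding openin_euclidean_subtopology_iff by blast
  moreover have "\<exists>c. path c \<and> path_image c \<subseteq> X \<inter> ball z e \<and> pathstart c = z \<and> pathfinish c = y"
    if "y \<in> U" for y
    using U(2-4) that unfolding path_connected_def by (meson order_trans)
  ultimately show ?thesis by (metis dist_commute)
qed

text \<open>The library's \<^const>\<open>subpath\<close> is restricted to normed vector spaces.\<close>

definition subarc :: "real \<Rightarrow> real \<Rightarrow> (real \<Rightarrow> 'a) \<Rightarrow> real \<Rightarrow> 'a" where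
  "subarc a b p = p \<circ> linepath a b"

lemma subarc_ends [simp]: "pathstart (subarc a b p) = p a" "pathfinish (subarc a b p) = p b"
  by (simp_all add: subarc_def pathstart_def pathfinish_def linepath_def)

lemma subarc_0_1 [simp]: "subarc 0 1 p = p"
  by (simp add: subarc_def fun_eq_iff linepath_def)

lemma path_image_subarc: "path_image (subarc a b p) = p ` closed_segment a b"
  by (metis subarc_def path_image_compose path_image_linepath)

text \<open>Used with \<open>c\<close> the holonomy of a path leading to a loop: triviality of the
  loop does not depend on the path along which it is carried.\<close>

lemma (in Group.group) conjugate_eq_oneD:
  assumes "c \<in> carrier G" "s \<in> carrier G" "c \<otimes> (s \<otimes> inv c) = \<one>"
  shows "s = \<one>"
proof -
  have "inv (inv c) = c \<otimes> s"
    using assms by (intro inv_equality) (simp_all add: m_assoc)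
  then have "c \<otimes> s = c \<otimes> \<one>" using assms by simp
  then show ?thesis using assms by simp
qed

context loop_quotient begin

section \<open>Subarcs and squares between nearby paths\<close>

lemma path_in_subarc:
  assumes "path_in p" "a \<in> {0..1}" "b \<in> {0..1}"
  shows "path_in (subarc a b p)"
proof -
  have seg: "closed_segment a b \<subseteq> {0..1}"
    using assms by (intro closed_segment_subset) auto
  then have "path (subarc a b p)"
    using assms unfolding subarc_def
    by (intro path_continuous_image) (auto simp: path_in_def path_def intro: continuous_on_subset)
  moreover have "path_image (subarc a b p) \<subseteq> X"
    unfolding path_image_subarc using assms(1) seg by (auto simp: path_in_def path_image_def)
  ultimately show ?thesis by (simp add: path_in_def)
qed

text \<open>The homotopy is found in the interval, for \<open>a\<close>, \<open>b\<close>,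
  \<open>c\<close> in any order, and pushed forward along \<open>p\<close>.\<close>

lemma holonomy_subarc:
  assumes p: "path_in p" and abc: "a \<in> {0..1}" "b \<in> {0..1}" "c \<in> {0..1}"
  shows "holonomy (subarc a c p) = holonomy (subarc a b p) \<otimes>\<^bsub>Q\<^esub> holonomy (subarc b c p)"
proof -
  have "subpath a b id = linepath a b" for a b :: real
    by (simp add: fun_eq_iff subpath_def linepath_def algebra_simps)
  then have "homotopic_paths {0..1} (linepath a b +++ linepath b c) (linepath a c)"
    using homotopic_join_subpaths[of "id :: real \<Rightarrow> real" "{0..1}" a b c] abc
    by (simp add: path_def path_image_def)
  then have "homotopic_paths X (p \<circ> (linepath a b +++ linepath b c)) (p \<circ> linepath a c)"
    by (rule homotopic_paths_continuous_image) (use p in \<open>auto simp: path_in_def path_def path_image_def\<close>)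
  then have "holonomy (subarc a c p) = holonomy (subarc a b p +++ subarc b c p)"
    unfolding subarc_def path_compose_join by (rule holonomy_homotopic[symmetric])
  also have "\<dots> = holonomy (subarc a b p) \<otimes>\<^bsub>Q\<^esub> holonomy (subarc b c p)"
    using p abc by (intro holonomy_join path_in_subarc) auto
  finally show ?thesis .
qed

text \<open>Local path connectedness joins \<open>z\<close> to the start of \<open>s\<close> inside
  the larger ball. Conjugation by such a path yields a small loop at \<open>z\<close> and does not
  affect triviality.\<close>

lemma free_small_loops_trivial:
  assumes lpc: "locally path_connected X" and "z \<in> X" "e > 0"
    and H: "\<And>s. path_in s \<Longrightarrow> pathstart s = z \<Longrightarrow> pathfinish s = z \<Longrightarrow> path_image s \<subseteq> ball z e
      \<Longrightarrow> holonomy s = \<one>\<^bsub>Q\<^esub>"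
  obtains r where "r > 0"
    "\<And>s. path_in s \<Longrightarrow> pathstart s = pathfinish s \<Longrightarrow> path_image s \<subseteq> ball z r \<Longrightarrow> holonomy s = \<one>\<^bsub>Q\<^esub>"
proof -
  obtain r where r: "r > 0" "\<forall>y\<in>X. dist z y < r \<longrightarrow>
    (\<exists>c. path c \<and> path_image c \<subseteq> X \<inter> ball z e \<and> pathstart c = z \<and> pathfinish c = y)"
    using locally_path_connected_ball[OF lpc \<open>z \<in> X\<close> \<open>e > 0\<close>] by blast
  have "holonomy s = \<one>\<^bsub>Q\<^esub>"
    if s: "path_in s" "pathstart s = pathfinish s" "path_image s \<subseteq> ball z (min r e)" for s
  proof -
    have "pathstart s \<in> ball z (min r e)" using s(3) pathstart_in_path_image by blast
    then obtain c where "path c" "path_image c \<subseteq> X \<inter> ball z e" "pathstart c = z" "pathfinish c = pathstart s"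
      using r(2)[rule_format, of "pathstart s"] path_in_ends(1)[OF s(1)] by auto
    then have c: "path_in c" "path_image c \<subseteq> ball z e" "pathstart c = z" "pathfinish c = pathstart s"
      by (auto simp: path_in_def)
    have "holonomy (c +++ (s +++ reversepath c)) = \<one>\<^bsub>Q\<^esub>"
    proof (rule H)
      show "path_image (c +++ (s +++ reversepath c)) \<subseteq> ball z e"
        using c s by (intro subset_path_image_join) auto
    qed (use c s in auto)
    then have "holonomy c \<otimes>\<^bsub>Q\<^esub> (holonomy s \<otimes>\<^bsub>Q\<^esub> inv\<^bsub>Q\<^esub> holonomy c) = \<one>\<^bsub>Q\<^esub>"
      using c s by (simp add: holonomy_join holonomy_reverse)
    then show ?thesis
      by (rule Q.conjugate_eq_oneD[OF holonomy_in[OF c(1)] holonomy_in[OF s(1)]])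
  qed
  then show thesis using that[of "min r e"] r(1) \<open>e > 0\<close> by auto
qed

text \<open>A path \<open>q\<close> close to \<open>p\<close> spans with \<open>p\<close> a square that closes up modulo \<open>G\<close>. Since this is additive
  in \<open>[a, b]\<close>, bisection reduces it to short intervals.\<close>

definition small_square :: "(real \<Rightarrow> 'a) \<Rightarrow> real \<Rightarrow> real \<Rightarrow> real \<Rightarrow> bool" where
  "small_square p \<delta> a b \<longleftrightarrow> (\<forall>q c c'.
     path_in q \<longrightarrow> (\<forall>t\<in>{0..1}. dist (p t) (q t) < \<delta>) \<longrightarrow>
     path_in c \<longrightarrow> path_image c \<subseteq> ball (p a) \<delta> \<longrightarrow> pathstart c = p a \<longrightarrow> pathfinish c = q a \<longrightarrow>
     path_in c' \<longrightarrow> path_image c' \<subseteq> ball (p b) \<delta> \<longrightarrow> pathstart c' = p b \<longrightarrow> pathfinish c' = q b \<longrightarrow>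
     holonomy (subarc a b p) \<otimes>\<^bsub>Q\<^esub> holonomy c' = holonomy c \<otimes>\<^bsub>Q\<^esub> holonomy (subarc a b q))"

text \<open>The two squares are glued along a short path from \<open>p b\<close> to
  \<open>q b\<close>. Local path connectedness provides it once \<open>q b\<close> is within
  \<open>r\<close> of \<open>p b\<close>, hence the bound \<open>min \<epsilon> r\<close>.\<close>

lemma small_square_trans:
  assumes lpc: "locally path_connected X" and p: "path_in p"
    and ab: "0 \<le> a" "a \<le> b" "b \<le> c" "c \<le> 1"
    and "\<delta>1 > 0" and S1: "small_square p \<delta>1 a b" and "\<delta>2 > 0" and S2: "small_square p \<delta>2 b c"
  shows "\<exists>\<delta>>0. small_square p \<delta> a c"
proof -
  define \<epsilon> where "\<epsilon> = min \<delta>1 \<delta>2"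
  have "p b \<in> X" using p ab by (auto simp: path_in_def path_image_def)
  have "\<epsilon> > 0" using \<open>\<delta>1 > 0\<close> \<open>\<delta>2 > 0\<close> by (simp add: \<epsilon>_def)
  obtain r where r: "r > 0" "\<forall>y\<in>X. dist (p b) y < r \<longrightarrow>
    (\<exists>c. path c \<and> path_image c \<subseteq> X \<inter> ball (p b) \<epsilon> \<and> pathstart c = p b \<and> pathfinish c = y)"
    using locally_path_connected_ball[OF lpc \<open>p b \<in> X\<close> \<open>\<epsilon> > 0\<close>] by blast
  have "small_square p (min \<epsilon> r) a c"
    unfolding small_square_def
  proof (intro allI impI)
    fix q d d'
    assume q: "path_in q" "\<forall>t\<in>{0..1}. dist (p t) (q t) < min \<epsilon> r"
      and d: "path_in d" "path_image d \<subseteq> ball (p a) (min \<epsilon> r)" "pathstart d = p a" "pathfinish d = q a"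
      and d': "path_in d'" "path_image d' \<subseteq> ball (p c) (min \<epsilon> r)" "pathstart d' = p c" "pathfinish d' = q c"
    have "q b \<in> X" "dist (p b) (q b) < r" using q ab by (auto simp: path_in_def path_image_def)
    then obtain m where "path m" "path_image m \<subseteq> X \<inter> ball (p b) \<epsilon>" "pathstart m = p b" "pathfinish m = q b"
      using r(2) by blast
    then have m: "path_in m" "path_image m \<subseteq> ball (p b) \<epsilon>" "pathstart m = p b" "pathfinish m = q b"
      by (auto simp: path_in_def)
    have in01: "a \<in> {0..1}" "b \<in> {0..1}" "c \<in> {0..1}" using ab by auto
    let ?A = "holonomy (subarc a b p)" and ?B = "holonomy (subarc b c p)"
    let ?A' = "holonomy (subarc a b q)" and ?B' = "holonomy (subarc b c q)"
    have C: "?A \<in> carrier Q" "?B \<in> carrier Q" "?A' \<in> carrier Q" "?B' \<in> carrier Q"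
      "holonomy d \<in> carrier Q" "holonomy d' \<in> carrier Q" "holonomy m \<in> carrier Q"
      using p q d d' m in01 by (auto intro!: holonomy_in path_in_subarc)
    have b1: "ball (p a) (min \<epsilon> r) \<subseteq> ball (p a) \<delta>1" "ball (p b) \<epsilon> \<subseteq> ball (p b) \<delta>1"
      "ball (p b) \<epsilon> \<subseteq> ball (p b) \<delta>2" "ball (p c) (min \<epsilon> r) \<subseteq> ball (p c) \<delta>2"
      by (auto simp: \<epsilon>_def)
    have close: "\<forall>t\<in>{0..1}. dist (p t) (q t) < \<delta>1" "\<forall>t\<in>{0..1}. dist (p t) (q t) < \<delta>2"
      using q(2) by (auto simp: \<epsilon>_def)
    have 1: "?A \<otimes>\<^bsub>Q\<^esub> holonomy m = holonomy d \<otimes>\<^bsub>Q\<^esub> ?A'"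
      using S1 q(1) close(1) d m order_trans[OF d(2) b1(1)] order_trans[OF m(2) b1(2)]
      unfolding small_square_def by blast
    have 2: "?B \<otimes>\<^bsub>Q\<^esub> holonomy d' = holonomy m \<otimes>\<^bsub>Q\<^esub> ?B'"
      using S2 q(1) close(2) d' m order_trans[OF m(2) b1(3)] order_trans[OF d'(2) b1(4)]
      unfolding small_square_def by blast
    have "holonomy (subarc a c p) \<otimes>\<^bsub>Q\<^esub> holonomy d' = ?A \<otimes>\<^bsub>Q\<^esub> (?B \<otimes>\<^bsub>Q\<^esub> holonomy d')"
      using holonomy_subarc[OF p in01] C Q.m_assoc by simp
    also have "\<dots> = (?A \<otimes>\<^bsub>Q\<^esub> holonomy m) \<otimes>\<^bsub>Q\<^esub> ?B'"
      using 2 C Q.m_assoc by simp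
    also have "\<dots> = holonomy d \<otimes>\<^bsub>Q\<^esub> holonomy (subarc a c q)"
      using 1 C holonomy_subarc[OF q(1) in01] Q.m_assoc by simp
    finally show "holonomy (subarc a c p) \<otimes>\<^bsub>Q\<^esub> holonomy d' = holonomy d \<otimes>\<^bsub>Q\<^esub> holonomy (subarc a c q)" .
  qed
  then show ?thesis using \<open>\<epsilon> > 0\<close> r(1) by (intro exI[of _ "min \<epsilon> r"]) auto
qed

text \<open>The four sides form one loop inside \<open>ball z r\<close>, which is trivial: the piece
  of \<open>p\<close> stays within \<open>r/3\<close> of \<open>z\<close>, and the other sides
  within a further \<open>r/3\<close> of points of that piece.\<close>

lemma small_square_local:
  assumes p: "path_in p" and "r > 0"
    and triv: "\<And>s. path_in s \<Longrightarrow> pathstart s = pathfinish s \<Longrightarrow> path_image s \<subseteq> ball z r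
      \<Longrightarrow> holonomy s = \<one>\<^bsub>Q\<^esub>"
    and ab: "0 \<le> a" "a \<le> b" "b \<le> 1" and near: "\<And>t. t \<in> {a..b} \<Longrightarrow> dist (p t) z < r/3"
  shows "small_square p (r/3) a b"
  unfolding small_square_def
proof (intro allI impI)
  fix q c c'
  assume q: "path_in q" "\<forall>t\<in>{0..1}. dist (p t) (q t) < r/3"
    and c: "path_in c" "path_image c \<subseteq> ball (p a) (r/3)" "pathstart c = p a" "pathfinish c = q a"
    and c': "path_in c'" "path_image c' \<subseteq> ball (p b) (r/3)" "pathstart c' = p b" "pathfinish c' = q b"
  have in01: "a \<in> {0..1}" "b \<in> {0..1}" using ab by auto
  let ?p = "subarc a b p" and ?q = "subarc a b q"
  have sub: "path_in ?p" "path_in ?q" using p q(1) in01 by (auto intro: path_in_subarc)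
  have ball3: "ball (p t) (r/3) \<subseteq> ball z r" if "t \<in> {a..b}" for t
  proof
    fix y assume "y \<in> ball (p t) (r/3)"
    then show "y \<in> ball z r"
      using near[OF that] dist_triangle[of z y "p t"] \<open>r > 0\<close> by (simp add: dist_commute)
  qed
  have im: "path_image ?p \<subseteq> ball z r" "path_image ?q \<subseteq> ball z r"
  proof -
    have "p t \<in> ball z r" "q t \<in> ball z r" if "t \<in> {a..b}" for t
    proof -
      have "p t \<in> ball (p t) (r/3)" "q t \<in> ball (p t) (r/3)"
        using \<open>r > 0\<close> q(2) that ab by auto
      then show "p t \<in> ball z r" "q t \<in> ball z r" using ball3[OF that] by blast+
    qed
    then show "path_image ?p \<subseteq> ball z r" "path_image ?q \<subseteq> ball z r"
      using ab(2) by (auto simp: path_image_subarc closed_segment_eq_real_ivl)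
  qed
  have imc: "path_image c \<subseteq> ball z r" "path_image c' \<subseteq> ball z r"
    using c(2) c'(2) ball3[of a] ball3[of b] ab by auto
  have "holonomy (?p +++ (c' +++ (reversepath ?q +++ reversepath c))) = \<one>\<^bsub>Q\<^esub>"
  proof (rule triv)
    show "path_image (?p +++ (c' +++ (reversepath ?q +++ reversepath c))) \<subseteq> ball z r"
      using im imc by (intro subset_path_image_join) auto
  qed (use sub c c' in auto)
  then have *: "holonomy ?p \<otimes>\<^bsub>Q\<^esub> (holonomy c' \<otimes>\<^bsub>Q\<^esub> (inv\<^bsub>Q\<^esub> holonomy ?q \<otimes>\<^bsub>Q\<^esub> inv\<^bsub>Q\<^esub> holonomy c)) = \<one>\<^bsub>Q\<^esub>"
    using sub c c' by (simp add: holonomy_join holonomy_reverse)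
  have C: "holonomy ?p \<in> carrier Q" "holonomy ?q \<in> carrier Q" "holonomy c \<in> carrier Q" "holonomy c' \<in> carrier Q"
    using sub c c' by (auto intro: holonomy_in)
  have "(holonomy ?p \<otimes>\<^bsub>Q\<^esub> holonomy c') \<otimes>\<^bsub>Q\<^esub> inv\<^bsub>Q\<^esub> (holonomy c \<otimes>\<^bsub>Q\<^esub> holonomy ?q) = \<one>\<^bsub>Q\<^esub>"
    using * C by (simp add: Q.m_assoc Q.inv_mult_group)
  then show "holonomy ?p \<otimes>\<^bsub>Q\<^esub> holonomy c' = holonomy c \<otimes>\<^bsub>Q\<^esub> holonomy ?q"
    using C by (metis Q.inv_closed Q.inv_equality Q.inv_inv Q.m_closed)
qed

text \<open>If every point had a radius below which all loops are trivial, bisection would assemble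
  the local squares along a loop of \<open>\<Union>G\<close> into one over the whole interval, and
  nearby loops would lie in \<open>\<Union>G\<close> too.\<close>

lemma small_nontrivial_loops:
  assumes lpc: "locally path_connected X"
    and not_open: "\<not> openin (mtopology_of (loop_space X x)) (\<Union>G)"
  shows "\<exists>z\<in>X. \<forall>e>0. \<exists>s. path_in s \<and> pathstart s = z \<and> pathfinish s = z
    \<and> path_image s \<subseteq> ball z e \<and> holonomy s \<noteq> \<one>\<^bsub>Q\<^esub>"
proof (rule ccontr)
  assume no_loops: "\<not> ?thesis"
  have triv: "\<exists>r>0. \<forall>s. path_in s \<longrightarrow> pathstart s = pathfinish s \<longrightarrow> path_image s \<subseteq> ball z r
      \<longrightarrow> holonomy s = \<one>\<^bsub>Q\<^esub>" if z: "z \<in> X" for z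
  proof -
    obtain e where "e > 0" and e: "\<not> (\<exists>s. path_in s \<and> pathstart s = z \<and> pathfinish s = z
        \<and> path_image s \<subseteq> ball z e \<and> holonomy s \<noteq> \<one>\<^bsub>Q\<^esub>)"
      using no_loops z by blast
    obtain r where "r > 0" "\<And>s. path_in s \<Longrightarrow> pathstart s = pathfinish s \<Longrightarrow>
        path_image s \<subseteq> ball z r \<Longrightarrow> holonomy s = \<one>\<^bsub>Q\<^esub>"
      using free_small_loops_trivial[OF lpc z \<open>e > 0\<close>] e by metis
    then show ?thesis by blast
  qed
  have "openin (mtopology_of (loop_space X x)) (\<Union>G)"
    unfolding openin_loop_space
  proof (intro conjI ballI Union_subset_loops)
    fix p assume pG: "p \<in> \<Union>G"
    then have p: "p \<in> loops X x" using Union_subset_loops by blast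
    have "0 \<le> (0::real) \<longrightarrow> 1 \<le> (1::real) \<longrightarrow> (\<exists>\<delta>>0. small_square p \<delta> 0 1)"
    proof (rule Bolzano[where P = "\<lambda>a b. 0 \<le> a \<longrightarrow> b \<le> 1 \<longrightarrow> (\<exists>\<delta>>0. small_square p \<delta> a b)"])
      fix a b c :: real
      assume "0 \<le> a \<longrightarrow> b \<le> 1 \<longrightarrow> (\<exists>\<delta>>0. small_square p \<delta> a b)"
        "0 \<le> b \<longrightarrow> c \<le> 1 \<longrightarrow> (\<exists>\<delta>>0. small_square p \<delta> b c)" "a \<le> b" "b \<le> c"
      then show "0 \<le> a \<longrightarrow> c \<le> 1 \<longrightarrow> (\<exists>\<delta>>0. small_square p \<delta> a c)"
        using small_square_trans[OF lpc loopsD(1)[OF p], of a b c] by (meson order_trans)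
    next
      fix t :: real assume t: "0 \<le> t" "t \<le> 1"
      then have "p t \<in> X" using p by (auto simp: loops_iff path_image_def)
      then obtain r where "r > 0" and r: "\<And>s. path_in s \<Longrightarrow> pathstart s = pathfinish s \<Longrightarrow>
          path_image s \<subseteq> ball (p t) r \<Longrightarrow> holonomy s = \<one>\<^bsub>Q\<^esub>"
        using triv by blast
      have "continuous_on {0..1} p" using p by (simp add: loops_iff path_def)
      moreover have "t \<in> {0..1}" "r/3 > 0" using t \<open>r > 0\<close> by auto
      ultimately obtain d where "d > 0"
        and d: "\<forall>u\<in>{0..1}. dist u t < d \<longrightarrow> dist (p u) (p t) < r/3"
        unfolding continuous_on_iff by blast
      have "small_square p (r/3) a b" if "a \<le> t" "t \<le> b" "b - a < d" "0 \<le> a" "b \<le> 1" for a b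
        using that
        by (intro small_square_local[OF loopsD(1)[OF p] \<open>r > 0\<close> r])
          (use d in \<open>auto simp: dist_real_def\<close>)
      then show "\<exists>d>0. \<forall>a b. a \<le> t \<and> t \<le> b \<and> b - a < d \<longrightarrow>
          0 \<le> a \<longrightarrow> b \<le> 1 \<longrightarrow> (\<exists>\<delta>>0. small_square p \<delta> a b)"
        using \<open>d > 0\<close> \<open>r > 0\<close> by (intro exI[of _ d]) (auto intro!: exI[of _ "r/3"])
    qed simp
    then obtain \<delta> where "\<delta> > 0" and \<delta>: "small_square p \<delta> 0 1" by auto
    have "q \<in> \<Union>G" if q: "q \<in> loops X x" "\<forall>t\<in>{0..1}. dist (p t) (q t) < \<delta>" for q
    proof -
      \<comment> \<open>Both loops start and end at \<open>x\<close>, so constant paths serve as the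
        two short sides of the square.\<close>
      have "p 0 = x" "p 1 = x" "q 0 = x" "q 1 = x" using p q by (auto simp: loops_iff pathstart_def pathfinish_def)
      then have "holonomy p \<otimes>\<^bsub>Q\<^esub> holonomy (\<lambda>_. x) = holonomy (\<lambda>_. x) \<otimes>\<^bsub>Q\<^esub> holonomy q"
        using \<delta>[unfolded small_square_def, rule_format, of q "\<lambda>_. x" "\<lambda>_. x"] q loopsD(1) base_in \<open>\<delta> > 0\<close>
        by (simp add: path_image_def)
      then have "holonomy p = holonomy q"
        using base_in p q by (simp add: holonomy_in loopsD(1))
      then show ?thesis
        using holonomy_eq_one_iff[OF p] holonomy_eq_one_iff[OF q(1)] pG by metis
    qed
    then show "\<exists>e>0. \<forall>q\<in>loops X x. (\<forall>t\<in>{0..1}. dist (p t) (q t) < e) \<longrightarrow> q \<in> \<Union>G"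
      using \<open>\<delta> > 0\<close> by blast
  qed
  then show False using not_open by blast
qed

end

section \<open>The cardinality of the quotient\<close>

context loop_quotient begin

text \<open>Each fibre of \<open>holonomy\<close> is open: concatenation with a reversed member of
  the fibre carries it into \<open>\<Union>G\<close> and does not increase distances. A countable
  dense set of loops therefore meets every fibre.\<close>

lemma countable_quotient_if_open:
  assumes sep: "separable_space (mtopology_of (loop_space X x))"
    and op: "openin (mtopology_of (loop_space X x)) (\<Union>G)"
  shows "carrier Q \<lesssim> (UNIV :: nat set)"
proof -
  obtain D where D: "countable D" "mtopology_of (loop_space X x) closure_of D = loops X x"
    using sep unfolding separable_space_def by auto
  have "A \<in> holonomy ` D" if A: "A \<in> carrier Q" for A
  proof -
    obtain p where p: "p \<in> loops X x" "A = holonomy p" using A unfolding carrier_Q by blast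
    let ?U = "{l \<in> loops X x. holonomy l = A}"
    have "openin (mtopology_of (loop_space X x)) ?U"
      unfolding openin_loop_space
    proof (intro conjI ballI)
      fix l assume "l \<in> ?U"
      then have l: "l \<in> loops X x" "holonomy l = A" by auto
      let ?r = "\<lambda>q. restrict (reversepath l +++ q) {0..1}"
      have r: "?r q \<in> loops X x" "holonomy (?r q) = inv\<^bsub>Q\<^esub> A \<otimes>\<^bsub>Q\<^esub> holonomy q" if "q \<in> loops X x" for q
        using loopsD(1-3)[OF l(1)] loopsD(1-3)[OF that] l(2)
        by (simp_all add: loopsI holonomy_restrict holonomy_join holonomy_reverse)
      have "?r l \<in> \<Union>G"
        using r[OF l(1)] l(2) A by (subst holonomy_eq_one_iff[symmetric]) auto
      then obtain e where "e > 0"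
        and e: "\<forall>q\<in>loops X x. (\<forall>t\<in>{0..1}. dist (?r l t) (q t) < e) \<longrightarrow> q \<in> \<Union>G"
        using op unfolding openin_loop_space by blast
      have "q \<in> ?U" if q: "q \<in> loops X x" "\<forall>t\<in>{0..1}. dist (l t) (q t) < e/2" for q
      proof -
        have "dist (?r l t) (?r q t) < e" if "t \<in> {0..1}" for t
        proof -
          have "dist ((reversepath l +++ l) t) ((reversepath l +++ q) t) \<le> e/2"
            by (rule dist_joinpaths_le) (use q(2) that \<open>e > 0\<close> in \<open>auto intro: less_imp_le\<close>)
          then show ?thesis using that \<open>e > 0\<close> by simp
        qed
        then have "?r q \<in> \<Union>G" using e r(1)[OF q(1)] by blast
        then have "inv\<^bsub>Q\<^esub> A \<otimes>\<^bsub>Q\<^esub> holonomy q = \<one>\<^bsub>Q\<^esub>"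
          using holonomy_eq_one_iff r[OF q(1)] by metis
        then have "inv\<^bsub>Q\<^esub> holonomy q = inv\<^bsub>Q\<^esub> A"
          using Q.inv_equality holonomy_in[OF loopsD(1)[OF q(1)]] A by blast
        then have "holonomy q = A"
          using holonomy_in[OF loopsD(1)[OF q(1)]] A by (metis Q.inv_inv)
        then show ?thesis using q(1) by simp
      qed
      then show "\<exists>e>0. \<forall>q\<in>loops X x. (\<forall>t\<in>{0..1}. dist (l t) (q t) < e) \<longrightarrow> q \<in> ?U"
        using \<open>e > 0\<close> half_gt_zero by blast
    qed auto
    moreover have "p \<in> ?U" "p \<in> mtopology_of (loop_space X x) closure_of D" using p D(2) by auto
    ultimately obtain q where "q \<in> D" "q \<in> ?U"
      using in_closure_of[of p "mtopology_of (loop_space X x)" D, THEN iffD1, THEN conjunct2, rule_format, of ?U]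
      by blast
    then show ?thesis by blast
  qed
  then have "carrier Q \<subseteq> holonomy ` D" by blast
  then have "countable (carrier Q)" using D(1) by (rule countable_subset[OF _ countable_image])
  then show ?thesis unfolding countable_def lepoll_def by blast
qed

section \<open>Continuum many cosets when the subgroup is not open\<close>

lemma holonomy_select_concat_Suc:
  assumes s: "\<And>n. path_in (s n)" "\<And>n. pathstart (s n) = z" "\<And>n. pathfinish (s n) = z"
    and null: "\<And>e. e > 0 \<Longrightarrow> \<exists>k. \<forall>n\<ge>k. \<forall>t\<in>{0..1}. dist (s n t) z \<le> e"
  shows "holonomy (select_concat z s a) = (if a 0 then holonomy (s 0) else \<one>\<^bsub>Q\<^esub>)
      \<otimes>\<^bsub>Q\<^esub> holonomy (select_concat z (\<lambda>n. s (Suc n)) (\<lambda>n. a (Suc n)))"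
    and "holonomy (select_concat z s a) \<in> carrier Q"
proof -
  have "z \<in> X" using path_in_ends(1)[OF s(1)[of 0]] s(2)[of 0] by simp
  have null': "\<exists>k. \<forall>n\<ge>k. \<forall>t\<in>{0..1}. dist (s (Suc n) t) z \<le> e" if "e > 0" for e
    using null[OF that] le_SucI by blast
  have t: "path_in (select_concat z (\<lambda>n. s (Suc n)) c)"
    "pathstart (select_concat z (\<lambda>n. s (Suc n)) c) = z" for c
    using select_concat_path[of "\<lambda>n. s (Suc n)" z X c] s null' by (auto simp: path_in_def)
  then show "holonomy (select_concat z s a) = (if a 0 then holonomy (s 0) else \<one>\<^bsub>Q\<^esub>)
      \<otimes>\<^bsub>Q\<^esub> holonomy (select_concat z (\<lambda>n. s (Suc n)) (\<lambda>n. a (Suc n)))"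
    using \<open>z \<in> X\<close> s(1,3) by (subst select_concat_Suc) (simp add: holonomy_join)
  show "holonomy (select_concat z s a) \<in> carrier Q"
    using select_concat_path[of s z X a] s null by (intro holonomy_in) (auto simp: path_in_def)
qed

text \<open>The segments before \<open>n\<close> are common factors that are peeled off by
  induction. The tail after \<open>n\<close> is common as well and cancels without its value being
  known.\<close>

lemma holonomy_select_concat_neq:
  assumes s: "\<And>n. path_in (s n)" "\<And>n. pathstart (s n) = z" "\<And>n. pathfinish (s n) = z"
    and null: "\<And>e. e > 0 \<Longrightarrow> \<exists>k. \<forall>n\<ge>k. \<forall>t\<in>{0..1}. dist (s n t) z \<le> e"
    and nontriv: "\<And>n. holonomy (s n) \<noteq> \<one>\<^bsub>Q\<^esub>"
    and "a n \<noteq> b n" "\<And>m. m \<noteq> n \<Longrightarrow> a m = b m"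
  shows "holonomy (select_concat z s a) \<noteq> holonomy (select_concat z s b)"
  using assms
proof (induction n arbitrary: s a b)
  case (0 s a b)
  have step: "holonomy (select_concat z s c) = (if c 0 then holonomy (s 0) else \<one>\<^bsub>Q\<^esub>)
      \<otimes>\<^bsub>Q\<^esub> holonomy (select_concat z (\<lambda>n. s (Suc n)) (\<lambda>n. c (Suc n)))" for c
    by (rule holonomy_select_concat_Suc(1)) (fact "0"(1-4))+
  have null': "\<exists>k. \<forall>n\<ge>k. \<forall>t\<in>{0..1}. dist (s (Suc n) t) z \<le> e" if "e > 0" for e
    using "0"(4)[OF that] le_SucI by blast
  have "holonomy (select_concat z (\<lambda>n. s (Suc n)) c) \<in> carrier Q" for c
    by (rule holonomy_select_concat_Suc(2)) (use "0"(1-3) null' in auto)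
  moreover have "(\<lambda>n. a (Suc n)) = (\<lambda>n. b (Suc n))" using "0"(7) by auto
  ultimately show ?case
    unfolding step using "0"(5)[of 0] "0"(5)[of 0, symmetric] "0"(6) holonomy_in[OF "0"(1)]
    by (cases "a 0"; cases "b 0") simp_all
next
  case (Suc n s a b)
  have step: "holonomy (select_concat z s c) = (if c 0 then holonomy (s 0) else \<one>\<^bsub>Q\<^esub>)
      \<otimes>\<^bsub>Q\<^esub> holonomy (select_concat z (\<lambda>n. s (Suc n)) (\<lambda>n. c (Suc n)))" for c
    by (rule holonomy_select_concat_Suc(1)) (fact Suc.prems(1-4))+
  have null': "\<exists>k. \<forall>n\<ge>k. \<forall>t\<in>{0..1}. dist (s (Suc n) t) z \<le> e" if "e > 0" for e
    using Suc.prems(4)[OF that] le_SucI by blast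
  have "holonomy (select_concat z (\<lambda>n. s (Suc n)) c) \<in> carrier Q" for c
    by (rule holonomy_select_concat_Suc(2)) (use Suc.prems(1-3) null' in auto)
  moreover have "holonomy (select_concat z (\<lambda>n. s (Suc n)) (\<lambda>n. a (Suc n)))
      \<noteq> holonomy (select_concat z (\<lambda>n. s (Suc n)) (\<lambda>n. b (Suc n)))"
    by (rule Suc.IH) (use Suc.prems null' in auto)
  moreover have "a 0 = b 0" using Suc.prems(7)[of 0] by simp
  ultimately show ?case
    unfolding step using holonomy_in[OF Suc.prems(1)] by auto
qed

lemma continuum_lepoll_quotient:
  assumes P: "nice_pointclass P" "pointclass_has_BP P"
    and lpc: "locally path_connected X" and polish: "polish_topology (top_of_set X)"
    and GP: "in_pointclass P (mtopology_of (loop_space X x)) (\<Union>G)"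
    and not_open: "\<not> openin (mtopology_of (loop_space X x)) (\<Union>G)"
  shows "(UNIV :: nat set set) \<lesssim> carrier Q"
proof -
  obtain z where "z \<in> X" and z: "\<forall>e>0. \<exists>s. path_in s \<and> pathstart s = z \<and> pathfinish s = z
    \<and> path_image s \<subseteq> ball z e \<and> holonomy s \<noteq> \<one>\<^bsub>Q\<^esub>"
    using small_nontrivial_loops[OF lpc not_open] by blast
  have "\<forall>n. \<exists>s. path_in s \<and> pathstart s = z \<and> pathfinish s = z
    \<and> path_image s \<subseteq> ball z (1 / real (Suc n)) \<and> holonomy s \<noteq> \<one>\<^bsub>Q\<^esub>"
    using z by simp
  then obtain s where s: "\<And>n. path_in (s n)" "\<And>n. pathstart (s n) = z" "\<And>n. pathfinish (s n) = z"
    and small: "\<And>n. path_image (s n) \<subseteq> ball z (1 / real (Suc n))"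
    and nontriv: "\<And>n. holonomy (s n) \<noteq> \<one>\<^bsub>Q\<^esub>"
    by (auto dest!: choice)
  have null: "\<exists>k. \<forall>n\<ge>k. \<forall>t\<in>{0..1}. dist (s n t) z \<le> e" if e: "e > 0" for e
  proof -
    obtain k where k: "1 / real (Suc k) < e" using nat_approx_posE[OF e] by blast
    have "dist (s n t) z \<le> e" if "n \<ge> k" "t \<in> {0..1}" for n t
    proof -
      have "s n t \<in> ball z (1 / real (Suc n))"
        using small[of n] that(2) unfolding path_image_def by blast
      then have "dist z (s n t) < 1 / real (Suc n)" by (simp only: mem_ball)
      also have "\<dots> \<le> 1 / real (Suc k)" using that(1) by (simp add: frac_le)
      finally show ?thesis using k by (simp add: dist_commute)
    qed
    then show ?thesis by blast
  qed
  define F where "F = select_concat z s"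
  have F: "path_in (F a)" "pathstart (F a) = z" "pathfinish (F a) = z" for a
    using select_concat_path[of s z X a] s null by (auto simp: path_in_def F_def)
  let ?g = "base_path z"
  note g = base_path[OF \<open>z \<in> X\<close>]
  \<comment> \<open>Equality of two holonomies has to become membership of a single loop at
    \<open>x\<close> in \<open>\<Union>G\<close>: their quotient, conjugated by the path
    \<open>?g\<close>.\<close>
  define K where "K c = restrict (?g +++ (F (fst \<circ> c) +++ (reversepath (F (snd \<circ> c)) +++ reversepath ?g))) {0..1}"
    for c :: "nat \<Rightarrow> bool \<times> bool"
  have K_loop: "K c \<in> loops X x" for c
    unfolding K_def using F g by (intro loopsI) auto
  have K_iff: "K c \<in> \<Union>G \<longleftrightarrow> holonomy (F (fst \<circ> c)) = holonomy (F (snd \<circ> c))" for c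
  proof -
    have "holonomy (K c) = holonomy ?g \<otimes>\<^bsub>Q\<^esub> ((holonomy (F (fst \<circ> c)) \<otimes>\<^bsub>Q\<^esub>
        inv\<^bsub>Q\<^esub> holonomy (F (snd \<circ> c))) \<otimes>\<^bsub>Q\<^esub> inv\<^bsub>Q\<^esub> holonomy ?g)"
      unfolding K_def using F g
      by (simp add: holonomy_restrict holonomy_join holonomy_reverse holonomy_in Q.m_assoc)
    also have "\<dots> = \<one>\<^bsub>Q\<^esub> \<longleftrightarrow> holonomy (F (fst \<circ> c)) \<otimes>\<^bsub>Q\<^esub> inv\<^bsub>Q\<^esub> holonomy (F (snd \<circ> c)) = \<one>\<^bsub>Q\<^esub>"
      using Q.conjugate_eq_oneD[OF holonomy_in[OF g(1)]] holonomy_in[OF g(1)] holonomy_in[OF F(1)]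
      by (metis Q.inv_closed Q.l_one Q.m_closed Q.r_inv)
    also have "\<dots> \<longleftrightarrow> holonomy (F (fst \<circ> c)) = holonomy (F (snd \<circ> c))"
    proof
      assume "holonomy (F (fst \<circ> c)) \<otimes>\<^bsub>Q\<^esub> inv\<^bsub>Q\<^esub> holonomy (F (snd \<circ> c)) = \<one>\<^bsub>Q\<^esub>"
      from Q.inv_equality[OF this] show "holonomy (F (fst \<circ> c)) = holonomy (F (snd \<circ> c))"
        using holonomy_in[OF F(1)] by simp
    next
      assume "holonomy (F (fst \<circ> c)) = holonomy (F (snd \<circ> c))"
      then show "holonomy (F (fst \<circ> c)) \<otimes>\<^bsub>Q\<^esub> inv\<^bsub>Q\<^esub> holonomy (F (snd \<circ> c)) = \<one>\<^bsub>Q\<^esub>"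
        using holonomy_in[OF F(1)] by simp
    qed
    finally show ?thesis unfolding holonomy_eq_one_iff[OF K_loop] .
  qed
  have "continuous_map seq_topology (mtopology_of (loop_space X x)) K"
  proof (rule continuous_map_loop_spaceI)
    fix c :: "nat \<Rightarrow> bool \<times> bool" and e :: real assume "e > 0"
    \<comment> \<open>Digits from \<open>k\<close> on govern only loops within \<open>e/2\<close> of
      \<open>z\<close>, so agreement below \<open>k\<close> suffices.\<close>
    obtain k where k: "\<forall>n\<ge>k. \<forall>t\<in>{0..1}. dist (s n t) z \<le> e/2" using null[of "e/2"] \<open>e > 0\<close> by auto
    let ?U = "{d. \<forall>i<k. d i = c i}"
    have "openin seq_topology ?U"
      unfolding openin_seq_topology by (rule ballI, rule exI[of _ k]) auto
    moreover have "dist (K c t) (K d t) < e" if d: "d \<in> ?U" and t: "t \<in> {0..1}" for d t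
    proof -
      have "dist (F (fst \<circ> c) t) (F (fst \<circ> d) t) \<le> e/2" "dist (F (snd \<circ> c) t) (F (snd \<circ> d) t) \<le> e/2"
        if "t \<in> {0..1}" for t
        unfolding F_def
        by (rule select_concat_close[where k = k]; use that k d \<open>e > 0\<close> in auto)+
      then have "dist ((?g +++ (F (fst \<circ> c) +++ (reversepath (F (snd \<circ> c)) +++ reversepath ?g))) t)
          ((?g +++ (F (fst \<circ> d) +++ (reversepath (F (snd \<circ> d)) +++ reversepath ?g))) t) \<le> e/2"
        using t \<open>e > 0\<close> by (intro dist_joinpaths_le dist_reversepath_le) auto
      then show ?thesis using t \<open>e > 0\<close> by (simp add: K_def)
    qed
    ultimately show "\<exists>U. openin seq_topology U \<and> c \<in> U \<and> (\<forall>d\<in>U. \<forall>t\<in>{0..1}. dist (K c t) (K d t) < e)"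
      by (intro exI[of _ ?U]) auto
  qed (rule K_loop)
  then have "baire_property seq_topology {c \<in> topspace seq_topology. K c \<in> \<Union>G}"
    using GP by (intro continuous_preimage_baire_property[OF P polish_seq_topology polish_loop_space[OF polish]])
  then have bp: "baire_property seq_topology {c. holonomy (F (fst \<circ> c)) = holonomy (F (snd \<circ> c))}"
    by (simp add: K_iff del: Union_iff)
  have equiv: "equivp (\<lambda>a b. holonomy (F a) = holonomy (F b))"
    by (auto intro!: equivpI reflpI sympI transpI)
  have flip: "holonomy (F a) \<noteq> holonomy (F (a(n := \<not> a n)))" for a n
    unfolding F_def by (rule holonomy_select_concat_neq[OF s null nontriv, of _ n]) auto
  obtain c :: "nat set \<Rightarrow> nat \<Rightarrow> bool" where "\<And>A B. A \<noteq> B \<Longrightarrow> holonomy (F (c A)) \<noteq> holonomy (F (c B))"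
    using continuum_many_classes[OF equiv bp flip] by blast
  then have "inj (\<lambda>A. holonomy (F (c A)))" by (meson injI)
  moreover have "range (\<lambda>A. holonomy (F (c A))) \<subseteq> carrier Q" using holonomy_in[OF F(1)] by blast
  ultimately show ?thesis unfolding lepoll_def by blast
qed

text \<open>Every coset is the holonomy of a loop, and the Polish loop space has a copy on a set of
  reals.\<close>

lemma quotient_lepoll_continuum:
  assumes "polish_topology (top_of_set X)"
  shows "carrier Q \<lesssim> (UNIV :: nat set set)"
proof -
  obtain T :: "real topology" and h where h: "homeomorphic_map (mtopology_of (loop_space X x)) T h"
    using polish_topology_homeomorphic_real[OF polish_loop_space[OF assms]] by blast
  have "inj_on h (loops X x)" using homeomorphic_imp_injective_map[OF h] by simp
  then have "loops X x \<lesssim> (UNIV :: real set)" unfolding lepoll_def by blast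
  moreover have "carrier Q \<lesssim> loops X x" unfolding carrier_Q by (rule image_lepoll)
  moreover have "(UNIV :: real set) \<approx> (UNIV :: nat set set)"
    using nat_sets_eqpoll_reals by (simp add: eqpoll_sym)
  ultimately show ?thesis by (meson eqpoll_imp_lepoll lepoll_trans)
qed

end

text \<open>The type \<open>nat set\<close> represents the continuum. When \<open>G\<close> is not
  open, the two bounds are combined by the Schroeder-Bernstein theorem.\<close>

theorem theorem3p13:
  fixes P :: pointclass and X :: "'a::metric_space set" and x :: 'a
    and G :: "(real \<Rightarrow> 'a) set set"
  assumes "nice_pointclass P" and "pointclass_has_BP P"
    and "path_connected X" and "locally path_connected X" and "polish_topology (top_of_set X)"
    and "x \<in> X"
    and "G \<lhd> fundamental_group X x"
    and "subgroup_of_pointclass P X x G"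
  shows "(open_subgroup X x G \<longrightarrow>
            carrier (fundamental_group X x Mod G) \<lesssim> (UNIV :: nat set)) \<and>
         (\<not> open_subgroup X x G \<longrightarrow>
            carrier (fundamental_group X x Mod G) \<approx> (UNIV :: nat set set))"
proof -
  interpret loop_quotient X x G by (rule loop_quotient.intro) (fact assms)+
  have "separable_space (mtopology_of (loop_space X x))"
    using polish_loop_space[OF assms(5)] by (simp add: polish_topology_def)
  then show ?thesis
    using countable_quotient_if_open quotient_lepoll_continuum[OF assms(5)]
      continuum_lepoll_quotient[OF assms(1,2,4,5)] assms(8)
    unfolding open_subgroup_def subgroup_of_pointclass_def by (blast intro: lepoll_antisym)
qed

end
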